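(* Let $\Pi$ be a positroid variety in the Grassmannian $\mathrm{Gr}(k,n)$. For each projected Deodhar parametrization of $\Pi$, there is a bridge graph whose bridge graph parametrization is the same map (i.e. sends each parameter tuple to the same point of $\mathrm{Gr}(k,n)$). Conversely, every bridge graph parametrization of $\Pi$ agrees with some projected Deodhar parametrization of $\Pi$.
   Context: A positroid variety $\Pi\subseteq \mathrm{Gr}(k,n)$ is the Zariski closure of a positroid cell of the totally nonnegative Grassmannian; equivalently it is the image $\pi_k(X_u^w)$ of a Richardson variety under the projection $\pi_k:\mathcal{F}\ell(n)\to\mathrm{Gr}(k,n)$, for $u\le_k w$ in $k$-Bruhat order. A parametrization of $\Pi$ of dimension $d$ is a regular map $(\mathbb{C}^\times)^d\to\Pi$ which is birational onto a dense subset of $\Pi$. Bridge graph parametrization: a bridge graph is a plabic graph built from a lollipop graph (corresponding to a $k$-subset $u([k])$) by successively adding bridges $(a_1,b_1),\dots,(a_d,b_d)$, each step being an inversion of the current bounded affine permutation with all boundary vertices strictly between $a_r,b_r$ being lollipops. Giving bridge $r$ weight $t_r$ and all other edges weight $1$, the parametrization sends $(t_1,\dots,t_d)$ to the row span of the $k\times n$ matrix with an identity in columns $u([k])$ and zeros elsewhere, multiplied on the right by $x_{(a_1,b_1)}(\pm t_1)\cdots x_{(a_d,b_d)}(\pm t_d)$, where $x_{(a,b)}(t)$ is the elementary matrix with entry $t$ in position $(a,b)$ and the sign is negative iff $|u([k])\cap[a_r+1,b_r-1]|$ is odd. Projected Deodhar parametrization: for $u\le_k w$, a reduced word $\mathbf{w}=s_{i_1}\cdots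 s_{i_m}$ for $w$, and $\mathbf{u}$ the positive distinguished subexpression (PDS) for $u$ in $\mathbf{w}$, the Marsh–Rietsch parametrization of the Deodhar component is $g_m\cdots g_1$ with $g_j=x_{i_j}(t_j)$ if $s_{i_j}\notin\mathbf{u}$ and $g_j=\dot{s}_{i_j}^{-1}$ if $s_{i_j}\in\mathbf{u}$; composing with the projection to $\mathrm{Gr}(k,n)$ (taking the first $k$ rows) gives a parametrization of $\Pi=\Pi_{\langle u,w\rangle_k}$. *)

theory Defs
  imports
    "Jordan_Normal_Form.DL_Rank"
    "HOL-Combinatorics.Permutations"
begin

text \<open>Indices are 0-based throughout: \<open>[n]\<close> is \<open>{..<n}\<close>, \<open>[k]\<close> is \<open>{..<k}\<close>, and \<open>s\<^sub>i\<close> exchanges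
  \<open>i\<close> and \<open>Suc i\<close>. Permutations of \<open>[n]\<close> are functions \<open>u\<close> with \<open>u permutes {..<n}\<close>, multiplied
  by composition.\<close>

section \<open>Bruhat order and \<open>k\<close>-Bruhat order\<close>

definition perm_length :: "nat \<Rightarrow> (nat \<Rightarrow> nat) \<Rightarrow> nat" where
  "perm_length n u = card {(i, j). i < j \<and> j < n \<and> u j < u i}"

definition bruhat_cover :: "nat \<Rightarrow> (nat \<Rightarrow> nat) \<Rightarrow> (nat \<Rightarrow> nat) \<Rightarrow> bool" where
  "bruhat_cover n u w \<longleftrightarrow>
     (\<exists>a b. a < b \<and> b < n \<and> w = u \<circ> transpose a b) \<and> perm_length n w = perm_length n u + 1"

definition bruhat_le :: "nat \<Rightarrow> (nat \<Rightarrow> nat) \<Rightarrow> (nat \<Rightarrow> nat) \<Rightarrow> bool" where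
  "bruhat_le n u w \<longleftrightarrow> u permutes {..<n} \<and> (bruhat_cover n)\<^sup>*\<^sup>* u w"

definition kbruhat_cover :: "nat \<Rightarrow> nat \<Rightarrow> (nat \<Rightarrow> nat) \<Rightarrow> (nat \<Rightarrow> nat) \<Rightarrow> bool" where
  "kbruhat_cover k n u w \<longleftrightarrow> bruhat_cover n u w \<and> u ` {..<k} \<noteq> w ` {..<k}"

definition kbruhat_le :: "nat \<Rightarrow> nat \<Rightarrow> (nat \<Rightarrow> nat) \<Rightarrow> (nat \<Rightarrow> nat) \<Rightarrow> bool" where
  "kbruhat_le k n u w \<longleftrightarrow> u permutes {..<n} \<and> (kbruhat_cover k n)\<^sup>*\<^sup>* u w"

section \<open>Grassmannians, flags, Richardson varieties and positroid varieties\<close>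

definition subspace_dim :: "nat \<Rightarrow> complex vec set \<Rightarrow> nat" where
  "subspace_dim n V = vectorspace.dim class_ring ((module_vec TYPE(complex) n)\<lparr>carrier := V\<rparr>)"

definition grassmannian :: "nat \<Rightarrow> nat \<Rightarrow> complex vec set set" where
  "grassmannian k n =
     {V. VectorSpace.subspace class_ring V (module_vec TYPE(complex) n) \<and> subspace_dim n V = k}"

definition flag_variety :: "nat \<Rightarrow> (nat \<Rightarrow> complex vec set) set" where
  "flag_variety n =
     {F \<in> extensional {..n}. (\<forall>i\<le>n. F i \<in> grassmannian i n) \<and> (\<forall>i<n. F i \<subseteq> F (Suc i))}"

definition coord_proj :: "nat \<Rightarrow> nat set \<Rightarrow> complex vec \<Rightarrow> complex vec" where
  "coord_proj n J v = vec n (\<lambda>i. if i \<in> J then v $ i else 0)"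

text \<open>The closed Richardson variety, as the intersection of two opposite Schubert varieties given by
  their rank conditions: \<open>u\<close> bounds the ranks on initial and \<open>w\<close> those on final intervals of
  columns. It is nonempty iff \<open>u \<le> w\<close>.\<close>

definition richardson_variety ::
    "nat \<Rightarrow> (nat \<Rightarrow> nat) \<Rightarrow> (nat \<Rightarrow> nat) \<Rightarrow> (nat \<Rightarrow> complex vec set) set" where
  "richardson_variety n u w =
     {F \<in> flag_variety n. \<forall>i\<le>n. \<forall>j\<le>n.
        subspace_dim n (coord_proj n {..<j} ` F i) \<le> card (u ` {..<i} \<inter> {..<j}) \<and>
        subspace_dim n (coord_proj n {j..<n} ` F i) \<le> card (w ` {..<i} \<inter> {j..<n})}"

definition projected_richardson ::
    "nat \<Rightarrow> nat \<Rightarrow> (nat \<Rightarrow> nat) \<Rightarrow> (nat \<Rightarrow> nat) \<Rightarrow> complex vec set set" where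
  "projected_richardson k n u w = (\<lambda>F. F k) ` richardson_variety n u w"

definition positroid_variety :: "nat \<Rightarrow> nat \<Rightarrow> complex vec set set \<Rightarrow> bool" where
  "positroid_variety k n X \<longleftrightarrow> (\<exists>u w. kbruhat_le k n u w \<and> X = projected_richardson k n u w)"

section \<open>Affine permutations\<close>

text \<open>The \<open>n\<close>-periodic extension of a permutation of \<open>[n]\<close>, and the translation
  \<open>i \<mapsto> i + n\<close> for \<open>i \<in> S\<close>, \<open>i \<mapsto> i\<close> for \<open>i \<in> [n] - S\<close>.\<close>

definition affine_ext :: "nat \<Rightarrow> (nat \<Rightarrow> nat) \<Rightarrow> int \<Rightarrow> int" where
  "affine_ext n u i = int (u (nat (i mod int n))) + int n * (i div int n)"

definition translation :: "nat \<Rightarrow> nat set \<Rightarrow> int \<Rightarrow> int" where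
  "translation n S i = (if nat (i mod int n) \<in> S then i + int n else i)"

text \<open>The bounded affine permutation \<open>u t w\<^sup>-\<^sup>1\<close>, with \<open>t\<close> the translation by \<open>[k]\<close>, which indexes the
  positroid variety of the \<open>k\<close>-Bruhat interval from \<open>u\<close> to \<open>w\<close>.\<close>

definition interval_affine_perm :: "nat \<Rightarrow> nat \<Rightarrow> (nat \<Rightarrow> nat) \<Rightarrow> (nat \<Rightarrow> nat) \<Rightarrow> int \<Rightarrow> int" where
  "interval_affine_perm k n u w =
     affine_ext n u \<circ> translation n {..<k} \<circ> affine_ext n (inv_into UNIV w)"

section \<open>Bridge graphs\<close>

text \<open>A bridge graph is encoded by the \<open>k\<close>-subset \<open>S\<close> of the initial lollipop graph and the list of
  its bridges in the order in which they are added. A boundary vertex is a lollipop as long as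
  no bridge has been attached to it. Adding a bridge \<open>(a, b)\<close> turns the bounded affine
  permutation \<open>f\<close> into \<open>f \<circ> (a b)\<close>.\<close>

definition lollipop :: "(nat \<times> nat) list \<Rightarrow> nat \<Rightarrow> bool" where
  "lollipop bs c \<longleftrightarrow> (\<forall>(a, b) \<in> set bs. c \<noteq> a \<and> c \<noteq> b)"

inductive bridge_graph ::
    "nat \<Rightarrow> nat \<Rightarrow> nat set \<Rightarrow> (nat \<times> nat) list \<Rightarrow> (int \<Rightarrow> int) \<Rightarrow> bool" for k n S where
  lollipops: "bridge_graph k n S [] (translation n S)"
    if "S \<subseteq> {..<n}" "card S = k"
| add_bridge: "bridge_graph k n S (bs @ [(a, b)]) (f \<circ> affine_ext n (transpose a b))"
    if "bridge_graph k n S bs f" "a < b" "b < n" "f (int b) < f (int a)"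
       "\<forall>c\<in>{a<..<b}. lollipop bs c"

definition torus :: "nat \<Rightarrow> complex list set" where
  "torus d = {ts. length ts = d \<and> 0 \<notin> set ts}"

definition prod_mat :: "nat \<Rightarrow> complex mat list \<Rightarrow> complex mat" where
  "prod_mat n As = foldr (*) As (1\<^sub>m n)"

definition subset_mat :: "nat \<Rightarrow> nat \<Rightarrow> nat set \<Rightarrow> complex mat" where
  "subset_mat k n S = mat k n (\<lambda>(i, j). if j = sorted_list_of_set S ! i then 1 else 0)"

definition bridge_sign :: "nat set \<Rightarrow> nat \<Rightarrow> nat \<Rightarrow> complex" where
  "bridge_sign S a b = (if odd (card (S \<inter> {a<..<b})) then - 1 else 1)"

definition bridge_param ::
    "nat \<Rightarrow> nat \<Rightarrow> nat set \<Rightarrow> (nat \<times> nat) list \<Rightarrow> complex list \<Rightarrow> complex vec set" where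
  "bridge_param k n S bs ts =
     vec_space.row_space n (subset_mat k n S *
       prod_mat n (map2 (\<lambda>(a, b) t. addrow_mat n (bridge_sign S a b * t) a b) bs ts))"

text \<open>The positroid variety of a bridge graph is the one indexed by its bounded affine
  permutation.\<close>

definition bridge_graph_for ::
    "nat \<Rightarrow> nat \<Rightarrow> complex vec set set \<Rightarrow> nat set \<Rightarrow> (nat \<times> nat) list \<Rightarrow> bool" where
  "bridge_graph_for k n X S bs \<longleftrightarrow>
     (\<exists>f u w. bridge_graph k n S bs f \<and> kbruhat_le k n u w \<and>
        f = interval_affine_perm k n u w \<and> X = projected_richardson k n u w)"

section \<open>Projected Deodhar parametrizations\<close>

definition simple_refl :: "nat \<Rightarrow> nat \<Rightarrow> nat" where
  "simple_refl i = transpose i (Suc i)"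

definition reduced_word :: "nat \<Rightarrow> nat list \<Rightarrow> (nat \<Rightarrow> nat) \<Rightarrow> bool" where
  "reduced_word n wd w \<longleftrightarrow>
     (\<forall>i\<in>set wd. Suc i < n) \<and> w = foldr (\<circ>) (map simple_refl wd) id \<and>
     length wd = perm_length n w"

text \<open>A subexpression of a word is a list of Booleans of the same length marking the letters that
  are used; \<open>partial_prod wd es j\<close> is the product of the used letters among the first \<open>j\<close> ones.\<close>

definition partial_prod :: "nat list \<Rightarrow> bool list \<Rightarrow> nat \<Rightarrow> nat \<Rightarrow> nat" where
  "partial_prod wd es j =
     foldr (\<circ>) (map2 (\<lambda>i e. if e then simple_refl i else id) (take j wd) (take j es)) id"

definition distinguished :: "nat \<Rightarrow> nat list \<Rightarrow> bool list \<Rightarrow> bool" where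
  "distinguished n wd es \<longleftrightarrow>
     (\<forall>j<length wd. bruhat_le n (partial_prod wd es (Suc j))
                                (partial_prod wd es j \<circ> simple_refl (wd ! j)))"

definition positive_distinguished :: "nat \<Rightarrow> nat list \<Rightarrow> bool list \<Rightarrow> (nat \<Rightarrow> nat) \<Rightarrow> bool" where
  "positive_distinguished n wd es u \<longleftrightarrow>
     length es = length wd \<and> partial_prod wd es (length wd) = u \<and> distinguished n wd es \<and>
     (\<forall>j<length wd. bruhat_le n (partial_prod wd es j) (partial_prod wd es (Suc j)))"

text \<open>The inverse of the lift of \<open>s\<^sub>i\<close> whose block in rows and columns \<open>i, i + 1\<close> has rows
  \<open>(0, -1)\<close> and \<open>(1, 0)\<close>.\<close>

definition refl_lift_inv :: "nat \<Rightarrow> nat \<Rightarrow> complex mat" where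
  "refl_lift_inv n i = mat n n (\<lambda>(p, q).
     if p = i \<and> q = Suc i then 1
     else if p = Suc i \<and> q = i then - 1
     else if p = q \<and> p \<noteq> i \<and> p \<noteq> Suc i then 1 else 0)"

text \<open>The parameters are numbered by their occurrence from left to right in
  \<open>g\<^sub>m \<cdots> g\<^sub>1\<close>, that is, by decreasing position in the word.\<close>

definition deodhar_factor :: "nat \<Rightarrow> nat list \<Rightarrow> bool list \<Rightarrow> complex list \<Rightarrow> nat \<Rightarrow> complex mat" where
  "deodhar_factor n wd es ts j =
     (if es ! j then refl_lift_inv n (wd ! j)
      else addrow_mat n (ts ! card {l. j < l \<and> l < length wd \<and> \<not> es ! l}) (wd ! j) (Suc (wd ! j)))"

definition deodhar_mat :: "nat \<Rightarrow> nat list \<Rightarrow> bool list \<Rightarrow> complex list \<Rightarrow> complex mat" where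
  "deodhar_mat n wd es ts = prod_mat n (map (deodhar_factor n wd es ts) (rev [0..<length wd]))"

definition deodhar_dim :: "bool list \<Rightarrow> nat" where
  "deodhar_dim es = length (filter Not es)"

definition deodhar_param ::
    "nat \<Rightarrow> nat \<Rightarrow> nat list \<Rightarrow> bool list \<Rightarrow> complex list \<Rightarrow> complex vec set" where
  "deodhar_param k n wd es ts =
     vec_space.row_space n (mat_of_rows n (take k (rows (deodhar_mat n wd es ts))))"

definition projected_deodhar_for ::
    "nat \<Rightarrow> nat \<Rightarrow> complex vec set set \<Rightarrow> nat list \<Rightarrow> bool list \<Rightarrow> bool" where
  "projected_deodhar_for k n X wd es \<longleftrightarrow>
     (\<exists>u w. kbruhat_le k n u w \<and> X = projected_richardson k n u w \<and>
        reduced_word n wd w \<and> positive_distinguished n wd es u)"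

end

theory Submission
  imports Defs
begin

text \<open>Moving all lifts of simple reflections in \<open>g\<^sub>m \<cdots> g\<^sub>1\<close> to the left turns a factor \<open>x\<^sub>i(t)\<close>
  into \<open>x\<^bsub>(v i, v (i+1))\<^esub>(\<plusminus>t)\<close>, where \<open>v\<close> is the partial product of the subexpression before that
  letter. This yields the bridges. That only lollipops lie under a bridge, and that the signs agree,
  follows from an invariant of the bounded affine permutation \<open>f\<close> built so far: whenever \<open>x > y\<close> and
  \<open>x\<close> precedes \<open>y\<close> in \<open>v\<close>, then \<open>f x = x + n\<close> or \<open>f y = y\<close>.

  Conversely, right multiplication of \<open>u\<close> and \<open>w\<close> by the same simple reflection of \<open>[k]\<close> or of its
  complement does not change the projected Richardson variety if both lengths increase, so \<open>u\<close> may be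
  assumed to be decreasing on \<open>[k]\<close> and on its complement. By the same invariant every descent of \<open>v\<close>
  may be sorted at any time; sorting no more than is needed to make the ends of the next bridge
  adjacent in \<open>v\<close> produces a reduced word.\<close>

section \<open>Length and Bruhat order\<close>

text \<open>One relation, \<open>sweep\<close>, is at the same time a word with a subexpression and
  a list of bridges. Both directions thus become existence statements for sweeps that end at
  \<open>v = id\<close>, with the word prescribed in one and the bridges prescribed in the other;
  equality of the two maps is a single induction over \<open>sweep\<close>. Building a sweep from a
  word involves no choice. Building one from bridges does, because sorting is irreversible: a pair
  of values that stands in increasing order in \<open>v\<close> stays so. If a value
  \<open>c\<close> with \<open>a < c < b\<close> once stands between \<open>a\<close> on its left
  and \<open>b\<close> on its right, it can never leave, and the bridge \<open>(a, b)\<close>, whose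
  ends must be adjacent, is lost. Such a \<open>c\<close> is still a lollipop when the bridge is
  due, so it suffices to keep each lollipop of the initial subset left of all smaller values and
  every other lollipop right of all larger ones. A \<open>u\<close> that decreases on both blocks
  starts out like this, and sorting only where it is unavoidable preserves it.\<close>

abbreviation pinv :: "('a \<Rightarrow> 'b) \<Rightarrow> 'b \<Rightarrow> 'a" where
  "pinv \<equiv> inv_into UNIV"

lemma simple_refl_simps [simp]:
  "simple_refl i i = Suc i" "simple_refl i (Suc i) = i"
  "simple_refl i (simple_refl i p) = p" "simple_refl i \<circ> simple_refl i = id"
  by (auto simp: simple_refl_def)

lemma simple_refl_other: "p \<noteq> i \<Longrightarrow> p \<noteq> Suc i \<Longrightarrow> simple_refl i p = p"
  by (simp add: simple_refl_def)

lemma simple_refl_less: "Suc i < n \<Longrightarrow> simple_refl i p < n \<longleftrightarrow> p < n"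
  by (auto simp: simple_refl_def transpose_def)

lemma permutes_simple_refl: "Suc i < n \<Longrightarrow> simple_refl i permutes {..<n}"
  unfolding simple_refl_def by (rule permutes_swap_id) auto

lemma simple_refl_mono:
  "p < q \<Longrightarrow> (p, q) \<noteq> (i, Suc i) \<Longrightarrow> simple_refl i p < simple_refl i q"
  by (auto simp: simple_refl_def transpose_def)

text \<open>\<open>simple_refl i\<close> reverses the order of no pair of positions except
  \<open>(i, Suc i)\<close>, so applying it to both entries carries the inversions of
  \<open>v\<close> to those of the product, with that one pair added.\<close>

lemma perm_length_ascent:
  assumes "Suc i < n" and "v i < v (Suc i)"
  shows "perm_length n (v \<circ> simple_refl i) = Suc (perm_length n v)"
proof -
  let ?s = "simple_refl i" and ?I = "\<lambda>v. {(p, q). p < q \<and> q < n \<and> v q < (v p :: nat)}"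
  let ?m = "\<lambda>(p, q). (?s p, ?s q)"
  have fin: "finite (?I v)"
    by (rule finite_subset[of _ "{..<n} \<times> {..<n}"]) auto
  have "?I (v \<circ> ?s) \<subseteq> insert (i, Suc i) (?m ` ?I v)"
  proof clarify
    fix p q assume pq: "p < q" "q < n" "(v \<circ> ?s) q < (v \<circ> ?s) p" "(p, q) \<notin> ?m ` ?I v"
    show "p = i \<and> q = Suc i"
    proof (rule ccontr)
      assume "\<not> (p = i \<and> q = Suc i)"
      then have "(?s p, ?s q) \<in> ?I v"
        using pq simple_refl_mono[of p q i] assms(1) by (auto simp: simple_refl_less)
      then have "?m (?s p, ?s q) \<in> ?m ` ?I v" by (rule imageI)
      then show False using pq(4) by simp
    qed
  qed
  moreover have "insert (i, Suc i) (?m ` ?I v) \<subseteq> ?I (v \<circ> ?s)"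
  proof -
    have "?m (p, q) \<in> ?I (v \<circ> ?s)" if "(p, q) \<in> ?I v" for p q
      using that simple_refl_mono[of p q i] assms
      by (cases "(p, q) = (i, Suc i)") (auto simp: simple_refl_less)
    then show ?thesis using assms by auto
  qed
  ultimately have eq: "?I (v \<circ> ?s) = insert (i, Suc i) (?m ` ?I v)" by blast
  have "(i, Suc i) \<notin> ?m ` ?I v"
  proof
    assume "(i, Suc i) \<in> ?m ` ?I v"
    then obtain p q where "p < q" "?s p = i" "?s q = Suc i" by auto
    moreover then have "p = Suc i" "q = i" by (metis simple_refl_simps)+
    ultimately show False by simp
  qed
  moreover have "inj_on ?m (?I v)"
    by (auto simp: inj_on_def) (metis simple_refl_simps(3))+
  ultimately show ?thesis
    unfolding perm_length_def eq using fin by (simp add: card_image)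
qed

lemma perm_length_descent:
  assumes "Suc i < n" and "v (Suc i) < v i"
  shows "Suc (perm_length n (v \<circ> simple_refl i)) = perm_length n v"
  using perm_length_ascent[of i n "v \<circ> simple_refl i"] assms by (simp add: comp_assoc)

lemma perm_length_le_ascent:
  assumes "inj v" and "Suc i < n"
  shows "perm_length n (v \<circ> simple_refl i) \<le> Suc (perm_length n v)"
proof -
  have "v i < v (Suc i) \<or> v (Suc i) < v i"
    using assms(1) by (metis injD n_not_Suc_n nat_neq_iff)
  then show ?thesis
    using perm_length_ascent[OF assms(2), of v] perm_length_descent[OF assms(2), of v] by auto
qed

text \<open>The transposition is factored as \<open>simple_refl a\<close> times
  \<open>transpose (Suc a) b\<close> times \<open>simple_refl a\<close>, which gives an induction on
  \<open>b - a\<close>. The length changes of the two outer factors cancel unless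
  \<open>v (Suc a)\<close> lies between \<open>v a\<close> and \<open>v b\<close>; in that case both
  are increases, which is the origin of the factor 2.\<close>

lemma perm_length_transpose:
  assumes "inj v" "a < b" "b < n" "v a < v b"
  shows "perm_length n (v \<circ> transpose a b) =
    perm_length n v + 1 + 2 * card {c. a < c \<and> c < b \<and> v a < v c \<and> v c < v b}"
  using assms
proof (induction "b - a" arbitrary: a v)
  case 0
  then show ?case by simp
next
  case (Suc d)
  show ?case
  proof (cases "b = Suc a")
    case True
    then have "{c. a < c \<and> c < b \<and> v a < v c \<and> v c < v b} = {}" by auto
    then show ?thesis
      using perm_length_ascent[of a n v] Suc.prems True by (simp add: simple_refl_def)
  next
    case False
    let ?c = "Suc a" and ?s = "simple_refl a"
    let ?x = "v \<circ> ?s"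
    let ?y = "?x \<circ> transpose ?c b"
    let ?B = "\<lambda>a'. {c. a' < c \<and> c < b \<and> v a < v c \<and> v c < v b}"
    have lt: "?c < b" using False Suc.prems by simp
    have ca: "v ?c \<noteq> v a" and cb: "v ?c \<noteq> v b"
      using Suc.prems(1) lt by (metis injD n_not_Suc_n, metis injD nat_less_le)
    have injx: "inj ?x"
      using Suc.prems(1) by (intro inj_compose) (auto simp: simple_refl_def)
    have xb: "?x b = v b" using lt by (simp add: simple_refl_other)
    have setx: "{c. ?c < c \<and> c < b \<and> ?x ?c < ?x c \<and> ?x c < ?x b} = ?B ?c"
      using lt by (auto simp: simple_refl_def transpose_def)
    have 1: "perm_length n ?y = perm_length n ?x + 1 + 2 * card (?B ?c)"
      using Suc.hyps(1)[of ?c ?x] Suc.hyps(2) injx lt Suc.prems xb setx by simp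
    have eq: "v \<circ> transpose a b = ?y \<circ> ?s"
      using lt by (auto simp: simple_refl_def transpose_def fun_eq_iff)
    have ya: "?y a = v ?c" and yc: "?y ?c = v b"
      using lt by (auto simp: simple_refl_def transpose_def)
    have an: "Suc a < n" using lt Suc.prems by simp
    have finB: "finite (?B ?c)" by (rule finite_subset[of _ "{..<b}"]) auto
    have split: "a < c \<longleftrightarrow> c = ?c \<or> ?c < c" for c by auto
    have Bin: "?B a = insert ?c (?B ?c)" if "v a < v ?c" "v ?c < v b"
      using that lt unfolding split by auto
    have Bout: "?B a = ?B ?c" if "\<not> (v a < v ?c \<and> v ?c < v b)"
      using that lt unfolding split by auto
    have cin: "card (?B a) = Suc (card (?B ?c))" if "v a < v ?c" "v ?c < v b"
      using Bin[OF that] finB by simp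
    consider "v ?c < v a" | "v a < v ?c" "v ?c < v b" | "v b < v ?c"
      using ca cb by linarith
    then show ?thesis
    proof cases
      case 1
      then show ?thesis
        using \<open>perm_length n ?y = _\<close> Bout Suc.prems(4)
          perm_length_descent[OF an, of v] perm_length_ascent[OF an, of ?y]
        unfolding eq ya yc by simp
    next
      case 2
      then show ?thesis
        using \<open>perm_length n ?y = _\<close> cin
          perm_length_ascent[OF an, of v] perm_length_ascent[OF an, of ?y]
        unfolding eq ya yc by simp
    next
      case 3
      then show ?thesis
        using \<open>perm_length n ?y = _\<close> Bout Suc.prems(4)
          perm_length_ascent[OF an, of v] perm_length_descent[OF an, of ?y]
        unfolding eq ya yc by simp
    qed
  qed
qed

lemma perm_length_transpose_greater:
  assumes "inj v" "a < b" "b < n" "v b < v a"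
  shows "perm_length n (v \<circ> transpose a b) < perm_length n v"
proof -
  have "inj (v \<circ> transpose a b)" using assms(1) by (intro inj_compose) auto
  then show ?thesis
    using perm_length_transpose[of "v \<circ> transpose a b" a b n] assms by (simp add: comp_assoc)
qed

text \<open>An intermediate value would contribute 2 to the formula of
  \<open>perm_length_transpose\<close>, which is too much for a cover.\<close>

lemma bruhat_coverE:
  assumes "bruhat_cover n v w" and "v permutes {..<n}"
  obtains a b where "a < b" "b < n" "w = v \<circ> transpose a b" "v a < v b"
    "\<And>c. a < c \<Longrightarrow> c < b \<Longrightarrow> v c < v a \<or> v b < v c"
    "perm_length n w = perm_length n v + 1"
proof -
  from assms(1) obtain a b where ab: "a < b" "b < n" "w = v \<circ> transpose a b"
    and len: "perm_length n w = perm_length n v + 1"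
    unfolding bruhat_cover_def by blast
  have inj: "inj v" using assms(2) by (rule permutes_inj)
  have "v a < v b"
    using perm_length_transpose_greater[OF inj ab(1,2)] len ab inj
    by (metis add_lessD1 injD less_irrefl linorder_neqE_nat)
  moreover have "v c < v a \<or> v b < v c" if "a < c" "c < b" for c
  proof (rule ccontr)
    assume "\<not> (v c < v a \<or> v b < v c)"
    moreover have "v c \<noteq> v a" "v c \<noteq> v b" using inj that by (metis injD less_irrefl)+
    ultimately have "c \<in> {c. a < c \<and> c < b \<and> v a < v c \<and> v c < v b}" using that by auto
    moreover have "finite {c. a < c \<and> c < b \<and> v a < v c \<and> v c < v b}"
      by (rule finite_subset[of _ "{..<b}"]) auto
    ultimately have "card {c. a < c \<and> c < b \<and> v a < v c \<and> v c < v b} > 0"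
      using card_gt_0_iff by blast
    then show False
      using perm_length_transpose[OF inj ab(1,2) \<open>v a < v b\<close>] len unfolding ab(3) by linarith
  qed
  ultimately show thesis using that ab len by blast
qed

lemma bruhat_cover_permutes:
  assumes "bruhat_cover n v w" and "v permutes {..<n}"
  shows "w permutes {..<n}"
proof -
  from bruhat_coverE[OF assms] obtain a b where "a < b" "b < n" "w = v \<circ> transpose a b" .
  then show ?thesis using assms(2) by (auto intro!: permutes_compose permutes_swap_id)
qed

lemma bruhat_le_length:
  assumes "bruhat_le n v w"
  shows "perm_length n v \<le> perm_length n w"
proof -
  from assms have "(bruhat_cover n)\<^sup>*\<^sup>* v w" by (simp add: bruhat_le_def)
  then show ?thesis
    by (induction rule: rtranclp_induct) (auto simp: bruhat_cover_def)
qed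

lemma bruhat_le_ascent:
  assumes "v permutes {..<n}" "Suc i < n" "v i < v (Suc i)"
  shows "bruhat_le n v (v \<circ> simple_refl i)"
proof -
  have "bruhat_cover n v (v \<circ> simple_refl i)"
    unfolding bruhat_cover_def simple_refl_def
    using perm_length_ascent[OF assms(2,3)] assms(2) by (auto simp: simple_refl_def)
  then show ?thesis using assms(1) by (auto simp: bruhat_le_def)
qed

lemma bruhat_le_simple_refl_iff:
  assumes "v permutes {..<n}" "Suc i < n"
  shows "bruhat_le n v (v \<circ> simple_refl i) \<longleftrightarrow> v i < v (Suc i)"
proof
  assume "bruhat_le n v (v \<circ> simple_refl i)"
  then have "perm_length n v \<le> perm_length n (v \<circ> simple_refl i)" by (rule bruhat_le_length)
  then show "v i < v (Suc i)"
    using perm_length_descent[OF assms(2), of v] permutes_inj[OF assms(1)]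
    by (metis Suc_n_not_le_n injD linorder_neqE_nat n_not_Suc_n)
qed (rule bruhat_le_ascent[OF assms])

lemma perm_length_inv:
  assumes "v permutes {..<n}"
  shows "perm_length n (pinv v) = perm_length n v"
proof -
  let ?I = "\<lambda>v. {(p, q). p < q \<and> q < n \<and> v q < (v p :: nat)}"
  have lt: "v p < n \<longleftrightarrow> p < n" "pinv v p < n \<longleftrightarrow> p < n" for p
    using permutes_in_image[OF assms] permutes_in_image[OF permutes_inv[OF assms]] by auto
  note vi = permutes_inverses[OF assms]
  have "bij_betw (\<lambda>(p, q). (v q, v p)) (?I v) (?I (pinv v))"
    by (rule bij_betw_byWitness[where f' = "\<lambda>(p, q). (pinv v q, pinv v p)"])
      (auto simp: vi lt less_trans)
  then show ?thesis unfolding perm_length_def by (rule bij_betw_same_card[symmetric])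
qed

section \<open>Words in simple reflections and their lengths\<close>

definition word_perm :: "nat list \<Rightarrow> nat \<Rightarrow> nat" where
  "word_perm wd = foldr (\<circ>) (map simple_refl wd) id"

lemma word_perm_simps [simp]:
  "word_perm [] = id" "word_perm (i # wd) = simple_refl i \<circ> word_perm wd"
  by (simp_all add: word_perm_def)

lemma word_perm_append: "word_perm (xs @ ys) = word_perm xs \<circ> word_perm ys"
  by (induction xs) (auto simp: comp_assoc)

lemma permutes_word:
  "\<forall>i\<in>set wd. Suc i < n \<Longrightarrow> word_perm wd permutes {..<n}"
  by (induction wd) (auto intro: permutes_compose permutes_simple_refl permutes_id)

lemma inv_simple_refl_comp:
  assumes "y permutes {..<n}"
  shows "pinv (simple_refl i \<circ> y) = pinv y \<circ> simple_refl i"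
proof -
  have "pinv (simple_refl i) = simple_refl i"
    by (rule inv_unique_comp) simp_all
  moreover have "bij (simple_refl i)" by (simp add: simple_refl_def)
  ultimately show ?thesis by (simp add: o_inv_distrib permutes_bij[OF assms])
qed

lemma perm_length_id: "perm_length n id = 0"
  unfolding perm_length_def by (auto simp: card_eq_0_iff)

lemma perm_length_left_ascent:
  assumes "y permutes {..<n}" "Suc i < n" "pinv y i < pinv y (Suc i)"
  shows "perm_length n (simple_refl i \<circ> y) = Suc (perm_length n y)"
proof -
  have "perm_length n (simple_refl i \<circ> y) = perm_length n (pinv (simple_refl i \<circ> y))"
    using perm_length_inv permutes_compose[OF assms(1) permutes_simple_refl[OF assms(2)]] by simp
  also have "\<dots> = Suc (perm_length n (pinv y))"
    unfolding inv_simple_refl_comp[OF assms(1)] by (rule perm_length_ascent[OF assms(2,3)])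
  finally show ?thesis using perm_length_inv[OF assms(1)] by simp
qed

lemma perm_length_word_left_le:
  assumes "z permutes {..<n}"
  shows "\<forall>i\<in>set wd. Suc i < n \<Longrightarrow>
    perm_length n (word_perm wd \<circ> z) \<le> length wd + perm_length n z"
proof (induction wd)
  case (Cons i wd)
  let ?y = "word_perm wd \<circ> z"
  have p: "?y permutes {..<n}"
    using permutes_compose[OF assms permutes_word[of wd n]] Cons.prems by simp
  have p': "simple_refl i \<circ> ?y permutes {..<n}"
    using permutes_compose[OF p permutes_simple_refl] Cons.prems by simp
  have "perm_length n (simple_refl i \<circ> ?y) = perm_length n (pinv ?y \<circ> simple_refl i)"
    using perm_length_inv[OF p'] inv_simple_refl_comp[OF p] by simp
  also have "\<dots> \<le> Suc (perm_length n (pinv ?y))"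
    using Cons.prems by (intro perm_length_le_ascent permutes_inj[OF permutes_inv[OF p]]) auto
  finally have "perm_length n (simple_refl i \<circ> ?y) \<le> Suc (perm_length n ?y)"
    using perm_length_inv[OF p] by simp
  then show ?case using Cons by (auto simp: comp_def)
qed simp

lemma perm_length_word_right_le:
  "\<forall>i\<in>set wd. Suc i < n \<Longrightarrow> z permutes {..<n} \<Longrightarrow>
    perm_length n (z \<circ> word_perm wd) \<le> perm_length n z + length wd"
proof (induction wd arbitrary: z)
  case (Cons i wd)
  have i: "Suc i < n" using Cons.prems by simp
  have "perm_length n (z \<circ> simple_refl i \<circ> word_perm wd)
      \<le> perm_length n (z \<circ> simple_refl i) + length wd"
    using Cons.prems by (intro Cons.IH permutes_compose[OF permutes_simple_refl[OF i]]) auto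
  then show ?case
    using perm_length_le_ascent[OF permutes_inj[OF Cons.prems(2)] i]
    by (simp add: comp_def)
qed simp

text \<open>In the wiring diagram of a reduced word, the two strands that meet at the \<open>j\<close>-th letter are
  parallel to its right and end up inverted.\<close>

lemma reduced_word_suffix:
  assumes "reduced_word n wd w" "j < length wd"
  defines "y \<equiv> word_perm (drop (Suc j) wd)"
  shows "pinv y (wd ! j) < pinv y (Suc (wd ! j))"
    and "w (pinv y (Suc (wd ! j))) < w (pinv y (wd ! j))"
proof -
  let ?i = "wd ! j"
  define x where "x = word_perm (take j wd)"
  have wd: "wd = take j wd @ ?i # drop (Suc j) wd"
    using assms(2) by (simp add: id_take_nth_drop)
  have n: "\<forall>i\<in>set wd. Suc i < n" and len: "length wd = perm_length n w"
    using assms(1) by (auto simp: reduced_word_def)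
  have nx: "\<forall>i\<in>set (take j wd). Suc i < n" and ny: "\<forall>i\<in>set (drop (Suc j) wd). Suc i < n"
    using n by (meson in_set_takeD in_set_dropD)+
  have i: "Suc ?i < n" using n assms(2) by simp
  have px: "x permutes {..<n}" and py: "y permutes {..<n}"
    unfolding x_def y_def by (rule permutes_word[OF nx], rule permutes_word[OF ny])
  have w: "w = x \<circ> (simple_refl ?i \<circ> y)"
    using assms(1) wd unfolding reduced_word_def x_def y_def word_perm_def[symmetric]
    by (metis word_perm_append word_perm_simps(2))
  note pyi = permutes_inj[OF permutes_inv[OF py]]
  show "pinv y ?i < pinv y (Suc ?i)"
  \<comment> \<open>A letter that shortens the factor on its right leaves \<open>w\<close> with
    length at most \<open>length wd - 2\<close>, since every other letter adds at most one. The
    second claim is the same count with the factor on its left.\<close>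
  proof (rule ccontr)
    assume "\<not> pinv y ?i < pinv y (Suc ?i)"
    then have "pinv y (Suc ?i) < pinv y ?i"
      using injD[OF pyi, of ?i "Suc ?i"] by linarith
    then have "Suc (perm_length n (simple_refl ?i \<circ> y)) = perm_length n y"
      using perm_length_descent[OF i, of "pinv y"] perm_length_inv[OF py]
        perm_length_inv[OF permutes_compose[OF py permutes_simple_refl[OF i]]]
      by (simp add: inv_simple_refl_comp[OF py])
    moreover have "perm_length n y \<le> length wd - Suc j"
      using perm_length_word_left_le[OF permutes_id ny] by (simp add: y_def perm_length_id)
    moreover have "perm_length n w \<le> j + perm_length n (simple_refl ?i \<circ> y)"
      using perm_length_word_left_le[OF permutes_compose[OF py permutes_simple_refl[OF i]] nx]
        assms(2) by (simp add: w x_def)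
    ultimately show False using len assms(2) by linarith
  qed
  show "w (pinv y (Suc ?i)) < w (pinv y ?i)"
  proof (rule ccontr)
    assume "\<not> w (pinv y (Suc ?i)) < w (pinv y ?i)"
    then have "x (Suc ?i) \<le> x ?i"
      by (simp add: w permutes_inverses[OF py])
    then have "x (Suc ?i) < x ?i"
      using injD[OF permutes_inj[OF px], of ?i "Suc ?i"] by linarith
    then have "Suc (perm_length n (x \<circ> simple_refl ?i)) = perm_length n x"
      by (rule perm_length_descent[OF i])
    moreover have "perm_length n x \<le> j"
      using perm_length_word_left_le[OF permutes_id nx] assms(2)
      by (simp add: x_def perm_length_id)
    moreover have "perm_length n w \<le> perm_length n (x \<circ> simple_refl ?i) + (length wd - Suc j)"
      using perm_length_word_right_le[OF ny permutes_compose[OF permutes_simple_refl[OF i] px]]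
      by (simp add: w y_def comp_assoc)
    ultimately show False using len assms(2) by linarith
  qed
qed

section \<open>Chains in \<open>k\<close>-Bruhat order\<close>

lemma kbruhat_coverE:
  assumes "kbruhat_cover k n v w" "v permutes {..<n}"
  obtains a b where "a < k" "k \<le> b" "b < n" "w = v \<circ> transpose a b" "v a < v b"
    "\<And>c. a < c \<Longrightarrow> c < b \<Longrightarrow> v c < v a \<or> v b < v c"
    "perm_length n w = perm_length n v + 1"
proof -
  have c: "bruhat_cover n v w" and im: "v ` {..<k} \<noteq> w ` {..<k}"
    using assms(1) by (auto simp: kbruhat_cover_def)
  from bruhat_coverE[OF c assms(2)] obtain a b where ab: "a < b" "b < n" "w = v \<circ> transpose a b"
      "v a < v b" "\<And>c. a < c \<Longrightarrow> c < b \<Longrightarrow> v c < v a \<or> v b < v c"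
      "perm_length n w = perm_length n v + 1" by metis
  have "w ` {..<k} = v ` transpose a b ` {..<k}" by (simp add: ab(3) image_comp)
  moreover have "transpose a b ` {..<k} = {..<k}" if "b < k \<or> k \<le> a"
  proof -
    have "transpose a b permutes {..<k} \<or> (\<forall>c<k. transpose a b c = c)"
      using that ab(1) permutes_swap_id[of a "{..<k}" b] by (auto simp: transpose_def)
    then show ?thesis using permutes_image by force
  qed
  ultimately have "a < k" "k \<le> b" using im by (metis not_le)+
  then show thesis using that ab by blast
qed

lemma kbruhat_coverI:
  assumes "v permutes {..<n}" "a < k" "k \<le> b" "b < n"
    "perm_length n (v \<circ> transpose a b) = perm_length n v + 1"
  shows "kbruhat_cover k n v (v \<circ> transpose a b)"
proof -
  have "v b \<in> (v \<circ> transpose a b) ` {..<k}"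
    using assms(2) by (intro image_eqI[of _ _ a]) auto
  moreover have "v b \<notin> v ` {..<k}"
    using inj_image_mem_iff[OF permutes_inj[OF assms(1)]] assms(3) by simp
  ultimately have "v ` {..<k} \<noteq> (v \<circ> transpose a b) ` {..<k}" by metis
  then show ?thesis
    unfolding kbruhat_cover_def bruhat_cover_def using assms
    by (intro conjI exI[of _ a] exI[of _ b]) auto
qed

lemma kbruhat_le_permutes:
  assumes "kbruhat_le k n u w"
  shows "u permutes {..<n}" "w permutes {..<n}"
proof -
  show u: "u permutes {..<n}" using assms by (simp add: kbruhat_le_def)
  from assms have "(kbruhat_cover k n)\<^sup>*\<^sup>* u w" by (simp add: kbruhat_le_def)
  then show "w permutes {..<n}"
    by (induction rule: rtranclp_induct)
      (use u bruhat_cover_permutes in \<open>auto simp: kbruhat_cover_def\<close>)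
qed

text \<open>Along a cover the value at a position below \<open>k\<close> can only rise and the value
  at a position from \<open>k\<close> on can only fall. The changed value passes no other value on
  its own side of \<open>k\<close> in the wrong direction, because the positions between
  \<open>a\<close> and \<open>b\<close> carry no intermediate values.\<close>

lemma kbruhat_le_same_side:
  assumes "kbruhat_le k n u w" "p < q" "\<not> (p < k \<and> k \<le> q)" "u p < u q"
  shows "w p < w q"
proof -
  have u: "u permutes {..<n}" and "(kbruhat_cover k n)\<^sup>*\<^sup>* u w"
    using assms(1) by (auto simp: kbruhat_le_def)
  from this(2) show ?thesis
  proof (induction rule: rtranclp_induct)
    case base
    then show ?case by (rule assms(4))
  next
    case (step v w)
    have v: "v permutes {..<n}"
      using kbruhat_le_permutes(2)[of k n u v] u step(1) by (simp add: kbruhat_le_def)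
    from kbruhat_coverE[OF step(2) v] obtain a b where ab: "a < k" "k \<le> b" "w = v \<circ> transpose a b"
      "v a < v b" "\<And>c. a < c \<Longrightarrow> c < b \<Longrightarrow> v c < v a \<or> v b < v c" by metis
    have bt: "v q < v a \<or> v b < v q" if "p = a" "q \<noteq> b" using ab that assms(2,3) by simp
    have bt': "v p < v a \<or> v b < v p" if "q = b" "p \<noteq> a" using ab that assms(2,3) by simp
    consider "p = a" | "p = b" | "q = a" | "q = b" | "p \<notin> {a, b}" "q \<notin> {a, b}" by blast
    then show ?case
    proof cases
      case 1
      then show ?thesis using step.IH ab(1-4) bt assms(2,3) by (auto simp: transpose_def)
    next
      case 2
      then show ?thesis using step.IH ab(1-4) assms(2,3) by (auto simp: transpose_def)
    next
      case 3
      then show ?thesis using step.IH ab(1-4) assms(2,3) by (auto simp: transpose_def)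
    next
      case 4
      then show ?thesis using step.IH ab(1-4) bt' assms(2,3) by (auto simp: transpose_def)
    next
      case 5
      then show ?thesis using step.IH ab(3) by (simp add: transpose_def)
    qed
  qed
qed

text \<open>The whole chain is multiplied by \<open>simple_refl i\<close>. Its transpositions become
  conjugates whose ends stay on their sides of \<open>k\<close>, because
  \<open>Suc i \<noteq> k\<close>. By \<open>kbruhat_le_same_side\<close> all members of the chain
  ascend at \<open>i\<close>, so all lengths rise by one and covers remain covers.\<close>

lemma kbruhat_le_simple_refl:
  assumes "kbruhat_le k n u w" "Suc i < n" "Suc i \<noteq> k" "u i < u (Suc i)"
  shows "kbruhat_le k n (u \<circ> simple_refl i) (w \<circ> simple_refl i)"
proof -
  let ?s = "simple_refl i"
  have u: "u permutes {..<n}" and ch: "(kbruhat_cover k n)\<^sup>*\<^sup>* u w"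
    using assms(1) by (auto simp: kbruhat_le_def)
  have us: "v \<circ> ?s permutes {..<n}" if "v permutes {..<n}" for v
    using permutes_compose[OF permutes_simple_refl[OF assms(2)] that] .
  from ch have "(kbruhat_cover k n)\<^sup>*\<^sup>* (u \<circ> ?s) (w \<circ> ?s)"
  proof (induction rule: rtranclp_induct)
    case (step v w)
    have lev: "kbruhat_le k n u v" and lew: "kbruhat_le k n u w"
      using u step(1,2) by (auto simp: kbruhat_le_def)
    have v: "v permutes {..<n}" using kbruhat_le_permutes(2)[OF lev] .
    have asc: "v i < v (Suc i)" "w i < w (Suc i)"
      using kbruhat_le_same_side[OF lev, of i "Suc i"] kbruhat_le_same_side[OF lew, of i "Suc i"]
        assms(3,4) by auto
    from kbruhat_coverE[OF step(2) v] obtain a b where ab: "a < k" "k \<le> b" "b < n"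
      "w = v \<circ> transpose a b" "perm_length n w = perm_length n v + 1" by metis
    have conj: "w \<circ> ?s = v \<circ> ?s \<circ> transpose (?s a) (?s b)"
    proof
      fix x
      have "?s x = c \<longleftrightarrow> x = ?s c" for c by auto
      then show "(w \<circ> ?s) x = (v \<circ> ?s \<circ> transpose (?s a) (?s b)) x"
        unfolding ab(4) by (auto simp: transpose_def)
    qed
    have "?s a < k" "k \<le> ?s b" "?s b < n"
      using ab(1-3) assms(2,3) by (auto simp: simple_refl_def transpose_def)
    then have "kbruhat_cover k n (v \<circ> ?s) (v \<circ> ?s \<circ> transpose (?s a) (?s b))"
      using perm_length_ascent[OF assms(2) asc(1)] perm_length_ascent[OF assms(2) asc(2)] ab(5)
      by (intro kbruhat_coverI us v) (auto simp: conj[symmetric])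
    then show ?case using step.IH conj by (metis rtranclp.rtrancl_into_rtrancl)
  qed simp
  then show ?thesis using us[OF u] by (simp add: kbruhat_le_def)
qed

section \<open>Projected Richardson varieties\<close>

abbreviation vec_subspace :: "nat \<Rightarrow> complex vec set \<Rightarrow> bool" where
  "vec_subspace n V \<equiv> VectorSpace.subspace class_ring V (module_vec TYPE(complex) n)"

lemma vec_subspace_iff:
  "vec_subspace n V \<longleftrightarrow> V \<subseteq> carrier_vec n \<and> 0\<^sub>v n \<in> V \<and> (\<forall>v\<in>V. \<forall>w\<in>V. v + w \<in> V) \<and>
     (\<forall>c. \<forall>v\<in>V. c \<cdot>\<^sub>v v \<in> V)"
proof -
  interpret vec_space "TYPE(complex)" n .
  show ?thesis
    unfolding VectorSpace.subspace_def submodule_def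
    using vectorspace_axioms module_axioms
    by (auto simp: module_vec_simps class_ring_simps)
qed

text \<open>A maximal independent subset of \<open>V\<close> is a basis; it exists because
  independent sets of the ambient space have at most \<open>n\<close> elements. Span and
  independence are transferred between \<open>V\<close> as a space of its own and the ambient
  space.\<close>

lemma vec_subspace_basis:
  assumes "vec_subspace n V"
  obtains B where "finite B" "B \<subseteq> V" "LinearCombinations.module.lin_indpt class_ring (module_vec TYPE(complex) n) B"
    "LinearCombinations.module.span class_ring (module_vec TYPE(complex) n) B = V" "card B = subspace_dim n V"
proof -
  interpret vec_space "TYPE(complex)" n .
  interpret S: vectorspace class_ring "vs V" by (rule subspace_is_vs[OF assms])
  have sub: "submodule class_ring V (module_vec TYPE(complex) n)"
    using assms by (simp add: VectorSpace.subspace_def)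
  have VV: "V \<subseteq> carrier_vec n" using assms by (simp add: vec_subspace_iff)
  have li: "S.lin_indpt A \<longleftrightarrow> lin_indpt A" if "A \<subseteq> V" for A
    using span_li_not_depend(2)[OF that sub] by simp
  have "finite A \<and> card A \<le> n" if "A \<subseteq> V \<and> lin_indpt A" for A
    using li_le_dim[of A] that VV dim_is_n by auto
  moreover have "{} \<subseteq> V \<and> lin_indpt {}"
    unfolding lin_dep_def by auto
  ultimately obtain B where B: "finite B" "maximal B (\<lambda>A. A \<subseteq> V \<and> lin_indpt A)"
    using maximal_exists[of "\<lambda>A. A \<subseteq> V \<and> lin_indpt A" n "{}"] by blast
  then have BV: "B \<subseteq> V" "lin_indpt B" by (auto simp: maximal_def)
  have "maximal B (\<lambda>A. A \<subseteq> carrier (vs V) \<and> S.lin_indpt A)"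
    using B(2) li unfolding maximal_def by auto
  then have bas: "S.basis B" by (rule S.max_li_is_basis)
  then have "S.span B = V" by (simp add: S.basis_def)
  then have "span B = V" using span_li_not_depend(1)[OF BV(1) sub] by simp
  moreover have "card B = subspace_dim n V"
    using S.dim_basis[OF B(1) bas] by (simp add: subspace_dim_def)
  ultimately show thesis using that B(1) BV by blast
qed

lemma subspace_dim_ge_card:
  assumes "vec_subspace n V" "A \<subseteq> V" "LinearCombinations.module.lin_indpt class_ring (module_vec TYPE(complex) n) A"
  shows "card A \<le> subspace_dim n V"
proof -
  interpret vec_space "TYPE(complex)" n .
  interpret S: vectorspace class_ring "vs V" by (rule subspace_is_vs[OF assms(1)])
  have sub: "submodule class_ring V (module_vec TYPE(complex) n)"
    using assms by (simp add: VectorSpace.subspace_def)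
  obtain B where B: "finite B" "B \<subseteq> V" "span B = V" using vec_subspace_basis[OF assms(1)] by metis
  have "S.span B = V" using span_li_not_depend(1)[OF B(2) sub] B(3) by simp
  then have "S.fin_dim" unfolding S.fin_dim_def using B by auto
  moreover have "S.lin_indpt A" using span_li_not_depend(2)[OF assms(2) sub] assms(3) by simp
  ultimately show ?thesis
    using S.li_le_dim(2)[of A] assms(2) by (simp add: subspace_dim_def)
qed

lemma subspace_dim_le_card:
  assumes "vec_subspace n V" "A \<subseteq> V" "finite A" "V \<subseteq> LinearCombinations.module.span class_ring (module_vec TYPE(complex) n) A"
  shows "subspace_dim n V \<le> card A"
proof -
  interpret vec_space "TYPE(complex)" n .
  interpret S: vectorspace class_ring "vs V" by (rule subspace_is_vs[OF assms(1)])
  have sub: "submodule class_ring V (module_vec TYPE(complex) n)"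
    using assms by (simp add: VectorSpace.subspace_def)
  have "span A \<subseteq> V" using span_is_subset[OF assms(2) sub] .
  then have "S.span A = V" using span_li_not_depend(1)[OF assms(2) sub] assms(4) by auto
  then show ?thesis
    using S.gen_ge_dim[OF assms(3)] assms(2) by (simp add: subspace_dim_def)
qed

lemma subspace_dim_mono:
  assumes "vec_subspace n V" "vec_subspace n W" "V \<subseteq> W"
  shows "subspace_dim n V \<le> subspace_dim n W"
  using vec_subspace_basis[OF assms(1)] subspace_dim_ge_card[OF assms(2)] assms(3)
  by (metis subset_trans)

lemma subspace_dim_strict_mono:
  assumes "vec_subspace n V" "vec_subspace n W" "V \<subset> W"
  shows "subspace_dim n V < subspace_dim n W"
proof -
  interpret vec_space "TYPE(complex)" n .
  obtain B where B: "finite B" "B \<subseteq> V" "lin_indpt B" "span B = V" "card B = subspace_dim n V"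
    using vec_subspace_basis[OF assms(1)] by metis
  obtain x where x: "x \<in> W" "x \<notin> V" using assms(3) by blast
  have c: "B \<subseteq> carrier_vec n" "x \<in> carrier_vec n"
    using assms B(2) x by (auto simp: vec_subspace_iff)
  have xB: "x \<notin> B" using x B(2) by auto
  have "lin_indpt (insert x B)"
    using lin_dep_iff_in_span[of B x] c B(3,4) x(2) xB by auto
  then have "card (insert x B) \<le> subspace_dim n W"
    using subspace_dim_ge_card[OF assms(2), of "insert x B"] x B(2) assms(3) by auto
  then show ?thesis using B(1,5) xB by simp
qed

definition vec_extend :: "complex vec set \<Rightarrow> complex vec \<Rightarrow> complex vec set" where
  "vec_extend V x = {v + c \<cdot>\<^sub>v x | v c. v \<in> V}"

lemma vec_extend_subspace:
  assumes "vec_subspace n V" "x \<in> carrier_vec n"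
  shows "vec_subspace n (vec_extend V x)"
  unfolding vec_subspace_iff
proof (intro conjI ballI allI)
  have V: "V \<subseteq> carrier_vec n" "0\<^sub>v n \<in> V" "\<And>v w. v \<in> V \<Longrightarrow> w \<in> V \<Longrightarrow> v + w \<in> V"
    "\<And>c v. v \<in> V \<Longrightarrow> c \<cdot>\<^sub>v v \<in> V"
    using assms(1) by (auto simp: vec_subspace_iff)
  show "vec_extend V x \<subseteq> carrier_vec n" using V assms(2) by (auto simp: vec_extend_def)
  show "0\<^sub>v n \<in> vec_extend V x"
    unfolding vec_extend_def using V(2) assms(2)
    by (intro CollectI exI[of _ "0\<^sub>v n"] exI[of _ 0]) auto
  show "v + w \<in> vec_extend V x" if vw: "v \<in> vec_extend V x" "w \<in> vec_extend V x" for v w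
  proof -
    obtain v' c w' d where "v = v' + c \<cdot>\<^sub>v x" "w = w' + d \<cdot>\<^sub>v x" "v' \<in> V" "w' \<in> V"
      using vw by (auto simp: vec_extend_def)
    moreover have "v' + c \<cdot>\<^sub>v x + (w' + d \<cdot>\<^sub>v x) = (v' + w') + (c + d) \<cdot>\<^sub>v x"
      using calculation V(1) assms(2) by (intro eq_vecI) (auto simp: algebra_simps)
    ultimately show ?thesis using V(3) by (auto simp: vec_extend_def)
  qed
  show "d \<cdot>\<^sub>v v \<in> vec_extend V x" if v: "v \<in> vec_extend V x" for d v
  proof -
    obtain v' c where "v = v' + c \<cdot>\<^sub>v x" "v' \<in> V"
      using v unfolding vec_extend_def by blast
    moreover have "d \<cdot>\<^sub>v (v' + c \<cdot>\<^sub>v x) = d \<cdot>\<^sub>v v' + (d * c) \<cdot>\<^sub>v x"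
      using calculation V(1) assms(2) by (intro eq_vecI) (auto simp: algebra_simps)
    ultimately show ?thesis using V(4) by (auto simp: vec_extend_def)
  qed
qed

lemma vec_extend_superset:
  assumes "vec_subspace n V" "x \<in> carrier_vec n"
  shows "V \<subseteq> vec_extend V x" "x \<in> vec_extend V x"
proof -
  have V: "V \<subseteq> carrier_vec n" "0\<^sub>v n \<in> V" using assms(1) by (auto simp: vec_subspace_iff)
  show "V \<subseteq> vec_extend V x"
  proof
    fix v assume "v \<in> V"
    moreover have "v = v + 0 \<cdot>\<^sub>v x" using calculation V(1) assms(2) by (intro eq_vecI) auto
    ultimately show "v \<in> vec_extend V x" unfolding vec_extend_def by blast
  qed
  have "x = 0\<^sub>v n + 1 \<cdot>\<^sub>v x" using assms(2) by (intro eq_vecI) auto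
  then show "x \<in> vec_extend V x" using V(2) unfolding vec_extend_def by blast
qed

lemma vec_extend_subset:
  assumes "vec_subspace n W" "V \<subseteq> W" "x \<in> W"
  shows "vec_extend V x \<subseteq> W"
  using assms unfolding vec_subspace_iff vec_extend_def by blast

lemma subspace_dim_extend_le:
  assumes "vec_subspace n V" "x \<in> carrier_vec n"
  shows "subspace_dim n (vec_extend V x) \<le> Suc (subspace_dim n V)"
proof -
  interpret vec_space "TYPE(complex)" n .
  obtain B where B: "finite B" "B \<subseteq> V" "lin_indpt B" "span B = V" "card B = subspace_dim n V"
    using vec_subspace_basis[OF assms(1)] by metis
  have c: "insert x B \<subseteq> carrier_vec n"
    using assms B(2) by (auto simp: vec_subspace_iff)
  have sp: "vec_subspace n (span (insert x B))"
    by (rule span_is_subspace) (use c in simp)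
  have "V \<subseteq> span (insert x B)" using B(4) span_is_monotone[of B "insert x B"] by auto
  moreover have "x \<in> span (insert x B)" using in_own_span[of "insert x B"] c by auto
  ultimately have "vec_extend V x \<subseteq> span (insert x B)" by (intro vec_extend_subset[OF sp])
  then have "subspace_dim n (vec_extend V x) \<le> card (insert x B)"
    using vec_extend_superset[OF assms] B(1,2)
    by (intro subspace_dim_le_card vec_extend_subspace assms) auto
  also have "\<dots> \<le> Suc (card B)" by (simp add: card_insert_le_m1 card_insert_if B(1))
  finally show ?thesis using B(5) by simp
qed

section \<open>Ranks of coordinate projections\<close>

lemma coord_proj_carrier [simp]: "coord_proj n J v \<in> carrier_vec n"
  by (simp add: coord_proj_def)

lemma coord_proj_add:
  assumes "v \<in> carrier_vec n" "w \<in> carrier_vec n"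
  shows "coord_proj n J (v + w) = coord_proj n J v + coord_proj n J w"
  using assms by (intro eq_vecI) (auto simp: coord_proj_def)

lemma coord_proj_smult:
  assumes "v \<in> carrier_vec n"
  shows "coord_proj n J (c \<cdot>\<^sub>v v) = c \<cdot>\<^sub>v coord_proj n J v"
  using assms by (intro eq_vecI) (auto simp: coord_proj_def)

lemma coord_proj_zero: "coord_proj n J (0\<^sub>v n) = 0\<^sub>v n"
  by (intro eq_vecI) (auto simp: coord_proj_def)

lemma coord_proj_zero_antimono:
  assumes "coord_proj n J v = 0\<^sub>v n" "K \<subseteq> J"
  shows "coord_proj n K v = 0\<^sub>v n"
proof (rule eq_vecI)
  fix i assume i: "i < dim_vec (0\<^sub>v n :: complex vec)"
  then have "coord_proj n J v $ i = 0" using assms(1) by simp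
  then show "coord_proj n K v $ i = 0\<^sub>v n $ i"
    using i assms(2) by (auto simp: coord_proj_def split: if_splits)
qed (simp add: coord_proj_def)

lemma coord_proj_subspace:
  assumes "vec_subspace n V"
  shows "vec_subspace n (coord_proj n J ` V)"
  unfolding vec_subspace_iff
proof (intro conjI ballI allI)
  have V: "V \<subseteq> carrier_vec n" "0\<^sub>v n \<in> V" "\<And>v w. v \<in> V \<Longrightarrow> w \<in> V \<Longrightarrow> v + w \<in> V"
    "\<And>c v. v \<in> V \<Longrightarrow> c \<cdot>\<^sub>v v \<in> V"
    using assms(1) by (auto simp: vec_subspace_iff)
  show "coord_proj n J ` V \<subseteq> carrier_vec n" by auto
  show "0\<^sub>v n \<in> coord_proj n J ` V" using V(2) coord_proj_zero[of n J] by (metis imageI)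
  show "v + w \<in> coord_proj n J ` V" if vw: "v \<in> coord_proj n J ` V" "w \<in> coord_proj n J ` V" for v w
  proof -
    obtain v' w' where "v = coord_proj n J v'" "w = coord_proj n J w'" "v' \<in> V" "w' \<in> V"
      using vw by blast
    then show ?thesis using V(1,3) coord_proj_add[of v' n w' J] by (metis imageI subsetD)
  qed
  show "c \<cdot>\<^sub>v v \<in> coord_proj n J ` V" if v: "v \<in> coord_proj n J ` V" for c v
  proof -
    obtain v' where "v = coord_proj n J v'" "v' \<in> V" using v by blast
    then show ?thesis using V(1,4) coord_proj_smult[of v' n J c] by (metis imageI subsetD)
  qed
qed

lemma coord_proj_extend:
  assumes "vec_subspace n V" "x \<in> carrier_vec n"
  shows "coord_proj n J ` vec_extend V x = vec_extend (coord_proj n J ` V) (coord_proj n J x)"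
proof -
  have V: "V \<subseteq> carrier_vec n" using assms(1) by (auto simp: vec_subspace_iff)
  have "coord_proj n J (v + c \<cdot>\<^sub>v x) = coord_proj n J v + c \<cdot>\<^sub>v coord_proj n J x" if "v \<in> V" for v c
    using that V assms(2) coord_proj_add[of v n "c \<cdot>\<^sub>v x" J] coord_proj_smult[of x n J c] by auto
  then show ?thesis unfolding vec_extend_def by (auto simp: image_iff) metis+
qed

text \<open>\<open>W\<close> is \<open>A\<close> extended by a vector \<open>x\<close> of
  \<open>B - A\<close> that is killed by every projection of the chain that kills some vector of
  \<open>B - A\<close>. A projection that kills \<open>x\<close> does not see the difference between
  \<open>W\<close> and \<open>A\<close>. Under any other projection the images of \<open>W\<close>
  and \<open>B\<close> differ: two vectors with equal image would differ by a vector of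
  \<open>B\<close> that is killed, hence lies in \<open>A\<close>.\<close>

lemma subspace_refinement:
  assumes A: "vec_subspace n A" "subspace_dim n A = d"
    and B: "vec_subspace n B" "subspace_dim n B = Suc (Suc d)" and AB: "A \<subseteq> B"
    and J: "antimono J"
  obtains W where "W \<in> grassmannian (Suc d) n" "A \<subseteq> W" "W \<subseteq> B"
    "\<And>K. subspace_dim n (coord_proj n K ` W) \<le> Suc (subspace_dim n (coord_proj n K ` A))"
    "\<And>K. subspace_dim n (coord_proj n K ` W) \<le> subspace_dim n (coord_proj n K ` B)"
    "\<And>j :: nat. subspace_dim n (coord_proj n (J j) ` W) \<le> subspace_dim n (coord_proj n (J j) ` A) \<or>
      subspace_dim n (coord_proj n (J j) ` W) < subspace_dim n (coord_proj n (J j) ` B)"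
proof -
  let ?P = "\<lambda>j. \<exists>x\<in>B - A. coord_proj n (J j) x = 0\<^sub>v n"
  have "\<exists>x\<in>B - A. \<forall>j. coord_proj n (J j) x = 0\<^sub>v n \<or> \<not> ?P j"
  proof (cases "\<exists>j. ?P j")
    case True
    \<comment> \<open>The sets \<open>J j\<close> decrease, so a vector killed at the least possible
      index is killed at all later ones, and one vector serves all indices.\<close>
    define j where "j = (LEAST j. ?P j)"
    have "?P j" unfolding j_def by (rule LeastI_ex[OF True])
    then obtain x where x: "x \<in> B - A" "coord_proj n (J j) x = 0\<^sub>v n" by blast
    have "coord_proj n (J i) x = 0\<^sub>v n" if "?P i" for i
    proof -
      have "j \<le> i" unfolding j_def using that by (rule Least_le)
      then show ?thesis using coord_proj_zero_antimono[OF x(2)] antimonoD[OF J] by blast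
    qed
    then show ?thesis using x(1) by blast
  next
    case False
    have "A \<noteq> B" using A B by auto
    then show ?thesis using AB False by blast
  qed
  then obtain x where x: "x \<in> B" "x \<notin> A" and max: "\<And>j. coord_proj n (J j) x = 0\<^sub>v n \<or> \<not> ?P j"
    by blast
  have xc: "x \<in> carrier_vec n" using x(1) B(1) by (auto simp: vec_subspace_iff)
  let ?W = "vec_extend A x"
  have W: "vec_subspace n ?W" by (rule vec_extend_subspace[OF A(1) xc])
  have AW: "A \<subseteq> ?W" and xW: "x \<in> ?W" using vec_extend_superset[OF A(1) xc] by auto
  have WB: "?W \<subseteq> B" using vec_extend_subset[OF B(1) AB x(1)] .
  have "d < subspace_dim n ?W"
    using subspace_dim_strict_mono[OF A(1) W] AW xW x(2) A(2) by auto
  then have dW: "subspace_dim n ?W = Suc d"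
    using subspace_dim_extend_le[OF A(1) xc] A(2) by simp
  have up: "subspace_dim n (coord_proj n K ` ?W) \<le> Suc (subspace_dim n (coord_proj n K ` A))" for K
    unfolding coord_proj_extend[OF A(1) xc]
    by (intro subspace_dim_extend_le coord_proj_subspace[OF A(1)]) simp
  have mono: "subspace_dim n (coord_proj n K ` ?W) \<le> subspace_dim n (coord_proj n K ` B)" for K
    using WB by (intro subspace_dim_mono coord_proj_subspace W B(1)) auto
  have alt: "subspace_dim n (coord_proj n (J j) ` ?W) \<le> subspace_dim n (coord_proj n (J j) ` A) \<or>
      subspace_dim n (coord_proj n (J j) ` ?W) < subspace_dim n (coord_proj n (J j) ` B)" for j
  proof (cases "coord_proj n (J j) x = 0\<^sub>v n")
    case True
    have "coord_proj n (J j) ` ?W \<subseteq> coord_proj n (J j) ` A"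
      unfolding coord_proj_extend[OF A(1) xc] True
      using coord_proj_subspace[OF A(1), of "J j"]
      by (intro vec_extend_subset[OF coord_proj_subspace[OF A(1)]]) (simp_all add: vec_subspace_iff)
    then show ?thesis
      using subspace_dim_mono[OF coord_proj_subspace[OF W] coord_proj_subspace[OF A(1)]] by blast
  next
    case False
    have "?W \<noteq> B" using dW B(2) by auto
    then obtain y where y: "y \<in> B" "y \<notin> ?W" using WB by blast
    have "coord_proj n (J j) y \<notin> coord_proj n (J j) ` ?W"
    proof
      assume "coord_proj n (J j) y \<in> coord_proj n (J j) ` ?W"
      then obtain z where z: "z \<in> ?W" "coord_proj n (J j) y = coord_proj n (J j) z" by blast
      have c: "y \<in> carrier_vec n" "z \<in> carrier_vec n"
        using y(1) z(1) B(1) W by (auto simp: vec_subspace_iff)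
      let ?v = "y + (-1) \<cdot>\<^sub>v z"
      have "coord_proj n (J j) ?v = coord_proj n (J j) z + (-1) \<cdot>\<^sub>v coord_proj n (J j) z"
        using c z(2) by (simp add: coord_proj_add coord_proj_smult)
      also have "\<dots> = 0\<^sub>v n" by (intro eq_vecI) (auto simp: coord_proj_def)
      finally have "coord_proj n (J j) ?v = 0\<^sub>v n" .
      moreover have "?v \<in> B" using y(1) z(1) WB B(1) unfolding vec_subspace_iff by blast
      ultimately have "?v \<in> A" using max[of j] False by blast
      then have "?v + z \<in> ?W" using AW z(1) W unfolding vec_subspace_iff by blast
      moreover have "?v + z = y" using c by (intro eq_vecI) auto
      ultimately show False using y(2) by simp
    qed
    then have "coord_proj n (J j) ` ?W \<subset> coord_proj n (J j) ` B" using y(1) WB by blast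
    then show ?thesis
      using subspace_dim_strict_mono[OF coord_proj_subspace[OF W] coord_proj_subspace[OF B(1)]]
      by blast
  qed
  show thesis
    using that[of ?W] W dW AW WB up mono alt by (simp add: grassmannian_def)
qed

section \<open>Rank conditions on flags\<close>

definition rank_bounded ::
    "nat \<Rightarrow> (nat \<Rightarrow> nat) \<Rightarrow> (nat \<Rightarrow> nat set) \<Rightarrow> (nat \<Rightarrow> complex vec set) \<Rightarrow> bool" where
  "rank_bounded n u J F \<longleftrightarrow>
     (\<forall>i\<le>n. \<forall>j. subspace_dim n (coord_proj n (J j) ` F i) \<le> card (u ` {..<i} \<inter> J j))"

text \<open>Indexing the initial intervals by \<open>n - j\<close> makes both families decreasing,
  as \<open>subspace_refinement\<close> demands. Letting \<open>j\<close> exceed \<open>n\<close>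
  only repeats the empty set.\<close>

lemma richardson_variety_iff:
  "F \<in> richardson_variety n u w \<longleftrightarrow> F \<in> flag_variety n \<and>
    rank_bounded n u (\<lambda>j. {..<n - j}) F \<and> rank_bounded n w (\<lambda>j. {j..<n}) F"
proof -
  have 1: "(\<forall>j\<le>n. P {..<j}) \<longleftrightarrow> (\<forall>j. P {..<n - j})" for P :: "nat set \<Rightarrow> bool"
    by (metis diff_diff_cancel diff_le_self)
  have 2: "(\<forall>j\<le>n. P {j..<n}) \<longleftrightarrow> (\<forall>j. P {j..<n})" for P :: "nat set \<Rightarrow> bool"
    by (metis atLeastLessThan_empty nle_le order_refl)
  let ?U = "\<lambda>i J. subspace_dim n (coord_proj n J ` F i) \<le> card (u ` {..<i} \<inter> J)"
  let ?W = "\<lambda>i J. subspace_dim n (coord_proj n J ` F i) \<le> card (w ` {..<i} \<inter> J)"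
  have "F \<in> richardson_variety n u w \<longleftrightarrow> F \<in> flag_variety n \<and>
      (\<forall>i\<le>n. \<forall>j\<le>n. ?U i {..<j}) \<and> (\<forall>i\<le>n. \<forall>j\<le>n. ?W i {j..<n})"
    unfolding richardson_variety_def by blast
  then show ?thesis
    unfolding rank_bounded_def 1[of "?U _"] 2[of "?W _"] by blast
qed

lemma card_image_Suc:
  assumes "inj u"
  shows "card (u ` {..<Suc i} \<inter> J) = card (u ` {..<i} \<inter> J) + (if u i \<in> J then 1 else 0)"
proof -
  have "u i \<notin> u ` {..<i}" using inj_image_mem_iff[OF assms] by simp
  then show ?thesis by (auto simp: lessThan_Suc)
qed

lemma image_simple_refl:
  "l \<noteq> Suc i \<Longrightarrow> (u \<circ> simple_refl i) ` {..<l} = u ` {..<l}"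
proof -
  assume l: "l \<noteq> Suc i"
  have "simple_refl i ` {..<l} = {..<l}"
  proof (cases "Suc i < l")
    case True
    then show ?thesis by (intro permutes_image permutes_simple_refl)
  next
    case False
    then have "simple_refl i p = p" if "p < l" for p using that l by (simp add: simple_refl_other)
    then show ?thesis by simp
  qed
  then show ?thesis by (metis image_comp)
qed

lemma card_image_simple_refl:
  assumes "inj u"
  shows "card ((u \<circ> simple_refl i) ` {..<Suc i} \<inter> J) =
    card (u ` {..<i} \<inter> J) + (if u (Suc i) \<in> J then 1 else 0)"
proof -
  have "inj (u \<circ> simple_refl i)"
    using assms by (intro inj_compose) (auto simp: simple_refl_def)
  from card_image_Suc[OF this, of i J] show ?thesis
    unfolding image_simple_refl[OF n_not_Suc_n, of u i] by simp
qed

text \<open>The two families of bounds differ only in dimension \<open>Suc i\<close>, where one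
  counts \<open>u (Suc i)\<close> and the other \<open>u i\<close>.\<close>

lemma rank_bounded_simple_reflD:
  assumes "inj u" "rank_bounded n (u \<circ> simple_refl i) J F"
    "\<And>j. u (Suc i) \<in> J j \<Longrightarrow> u i \<in> J j"
  shows "rank_bounded n u J F"
  unfolding rank_bounded_def
proof (intro allI impI)
  fix l j assume l: "l \<le> n"
  have "subspace_dim n (coord_proj n (J j) ` F l) \<le> card ((u \<circ> simple_refl i) ` {..<l} \<inter> J j)"
    using assms(2) l by (simp add: rank_bounded_def)
  also have "\<dots> \<le> card (u ` {..<l} \<inter> J j)"
  proof (cases "l = Suc i")
    case True
    then show ?thesis
      using assms(3)[of j] card_image_simple_refl[OF assms(1), of i "J j"] card_image_Suc[OF assms(1), of i "J j"]
      by auto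
  next
    case False
    show ?thesis unfolding image_simple_refl[OF False] ..
  qed
  finally show "subspace_dim n (coord_proj n (J j) ` F l) \<le> card (u ` {..<l} \<inter> J j)" .
qed

text \<open>The condition on \<open>u\<close> says that the Schubert variety of \<open>u\<close> is a union of fibres of the map that
  forgets \<open>F (Suc i)\<close>, and that the one of \<open>u s\<^sub>i\<close> has the same image under this map.\<close>

lemma flag_refinement:
  assumes F: "F \<in> flag_variety n" and i: "Suc i < n" and J: "antimono J"
  obtains W where "F(Suc i := W) \<in> flag_variety n"
    "\<And>u K. inj u \<Longrightarrow> rank_bounded n u K F \<Longrightarrow> (\<And>j. u (Suc i) \<in> K j \<Longrightarrow> u i \<in> K j) \<Longrightarrow>
      rank_bounded n u K (F(Suc i := W))"
    "\<And>u. inj u \<Longrightarrow> rank_bounded n u J F \<Longrightarrow> rank_bounded n (u \<circ> simple_refl i) J (F(Suc i := W))"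
proof -
  have G: "F l \<in> grassmannian l n" if "l \<le> n" for l using F that by (simp add: flag_variety_def)
  have mono: "F l \<subseteq> F (Suc l)" if "l < n" for l using F that by (simp add: flag_variety_def)
  obtain W where W: "W \<in> grassmannian (Suc i) n" "F i \<subseteq> W" "W \<subseteq> F (Suc (Suc i))"
    "\<And>K. subspace_dim n (coord_proj n K ` W) \<le> Suc (subspace_dim n (coord_proj n K ` F i))"
    "\<And>K. subspace_dim n (coord_proj n K ` W) \<le> subspace_dim n (coord_proj n K ` F (Suc (Suc i)))"
    "\<And>j. subspace_dim n (coord_proj n (J j) ` W) \<le> subspace_dim n (coord_proj n (J j) ` F i) \<or>
      subspace_dim n (coord_proj n (J j) ` W) < subspace_dim n (coord_proj n (J j) ` F (Suc (Suc i)))"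
  proof -
    have "F i \<subseteq> F (Suc (Suc i))" using mono[of i] mono[of "Suc i"] i by simp
    moreover have "vec_subspace n (F i)" "subspace_dim n (F i) = i"
      "vec_subspace n (F (Suc (Suc i)))" "subspace_dim n (F (Suc (Suc i))) = Suc (Suc i)"
      using G[of i] G[of "Suc (Suc i)"] i by (simp_all add: grassmannian_def)
    ultimately show thesis
      using subspace_refinement[where A = "F i" and B = "F (Suc (Suc i))" and thesis = thesis, OF _ _ _ _ _ J]
        that by blast
  qed
  have 1: "F(Suc i := W) \<in> flag_variety n"
  proof -
    have "(F(Suc i := W)) l \<in> grassmannian l n" if "l \<le> n" for l using G[OF that] W(1) by simp
    moreover have "(F(Suc i := W)) l \<subseteq> (F(Suc i := W)) (Suc l)" if "l < n" for l
      using mono[OF that] W(2,3) by simp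
    moreover have "F(Suc i := W) \<in> extensional {..n}"
      using F i by (simp add: flag_variety_def extensional_def)
    ultimately show ?thesis by (simp add: flag_variety_def)
  qed
  have 2: "rank_bounded n u K (F(Suc i := W))"
    if u: "inj u" and r: "rank_bounded n u K F" and c: "\<And>j. u (Suc i) \<in> K j \<Longrightarrow> u i \<in> K j" for u K
    unfolding rank_bounded_def
  proof (intro allI impI)
    fix l j assume l: "l \<le> n"
    have ri: "subspace_dim n (coord_proj n (K j) ` F i) \<le> card (u ` {..<i} \<inter> K j)"
      and ri2: "subspace_dim n (coord_proj n (K j) ` F (Suc (Suc i))) \<le> card (u ` {..<Suc (Suc i)} \<inter> K j)"
      using r i by (auto simp: rank_bounded_def)
    show "subspace_dim n (coord_proj n (K j) ` (F(Suc i := W)) l) \<le> card (u ` {..<l} \<inter> K j)"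
    proof (cases "l = Suc i")
      case True
      then show ?thesis
        using W(4)[of "K j"] W(5)[of "K j"] ri ri2 c[of j]
          card_image_Suc[OF u, of i "K j"] card_image_Suc[OF u, of "Suc i" "K j"]
        by (auto split: if_splits)
    next
      case False
      then show ?thesis using r l by (simp add: rank_bounded_def)
    qed
  qed
  have 3: "rank_bounded n (u \<circ> simple_refl i) J (F(Suc i := W))"
    if u: "inj u" and r: "rank_bounded n u J F" for u
    unfolding rank_bounded_def
  proof (intro allI impI)
    fix l j assume l: "l \<le> n"
    have ri: "subspace_dim n (coord_proj n (J j) ` F i) \<le> card (u ` {..<i} \<inter> J j)"
      and ri2: "subspace_dim n (coord_proj n (J j) ` F (Suc (Suc i))) \<le> card (u ` {..<Suc (Suc i)} \<inter> J j)"
      using r i by (auto simp: rank_bounded_def)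
    show "subspace_dim n (coord_proj n (J j) ` (F(Suc i := W)) l) \<le>
        card ((u \<circ> simple_refl i) ` {..<l} \<inter> J j)"
    proof (cases "l = Suc i")
      case True
      \<comment> \<open>Either the rank is at most that of \<open>F i\<close>, or it is smaller than
        that of \<open>F (Suc (Suc i))\<close>, whose bound exceeds the desired one by at most
        one.\<close>
      then show ?thesis
        using W(6)[of j] ri ri2 card_image_simple_refl[OF u, of i "J j"]
          card_image_Suc[OF u, of i "J j"] card_image_Suc[OF u, of "Suc i" "J j"]
        by (auto split: if_splits)
    next
      case False
      then show ?thesis using r l unfolding image_simple_refl[OF False] by (simp add: rank_bounded_def)
    qed
  qed
  show thesis by (rule that[OF 1 2 3])
qed

text \<open>Only the space of dimension \<open>Suc i\<close> is replaced, so the one of dimension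
  \<open>k\<close> survives. Passing to the longer pair tightens the conditions of \<open>u\<close>
  and loosens those of \<open>w\<close>; passing back does the reverse. In each direction the
  tightened family dictates the choice of the new space by \<open>flag_refinement\<close>, while the
  looser one holds for every choice.\<close>

lemma projected_richardson_simple_refl:
  assumes u: "u permutes {..<n}" and w: "w permutes {..<n}" and i: "Suc i < n" "Suc i \<noteq> k"
    and asc: "u i < u (Suc i)" "w i < w (Suc i)"
  shows "projected_richardson k n (u \<circ> simple_refl i) (w \<circ> simple_refl i) =
    projected_richardson k n u w"
proof -
  let ?s = "simple_refl i" and ?I = "\<lambda>j. {..<n - j}" and ?T = "\<lambda>j. {j..<n}"
  have us: "u \<circ> ?s permutes {..<n}" and ws: "w \<circ> ?s permutes {..<n}"
    using permutes_compose[OF permutes_simple_refl[OF i(1)]] u w by auto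
  note inj = permutes_inj[OF u] permutes_inj[OF w] permutes_inj[OF us] permutes_inj[OF ws]
  have ss: "w \<circ> ?s \<circ> ?s = w" by (simp add: comp_assoc)
  have aI: "antimono ?I" and aT: "antimono ?T" by (auto simp: antimono_def)
  have cu: "u (Suc i) \<in> ?I j \<Longrightarrow> u i \<in> ?I j" for j using asc(1) by auto
  have "w (Suc i) < n" using permutes_in_image[OF w] i(1) by simp
  then have cw: "(w \<circ> ?s) (Suc i) \<in> ?T j \<Longrightarrow> (w \<circ> ?s) i \<in> ?T j" for j using asc(2) by auto
  have "\<exists>F'\<in>richardson_variety n u w. F' k = F k"
    if F: "F \<in> richardson_variety n (u \<circ> ?s) (w \<circ> ?s)" for F
  proof -
    have fl: "F \<in> flag_variety n" and r: "rank_bounded n (u \<circ> ?s) ?I F" "rank_bounded n (w \<circ> ?s) ?T F"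
      using F richardson_variety_iff by auto
    obtain W where W: "F(Suc i := W) \<in> flag_variety n"
      "\<And>u K. inj u \<Longrightarrow> rank_bounded n u K F \<Longrightarrow> (\<And>j. u (Suc i) \<in> K j \<Longrightarrow> u i \<in> K j) \<Longrightarrow>
        rank_bounded n u K (F(Suc i := W))"
      "\<And>u. inj u \<Longrightarrow> rank_bounded n u ?T F \<Longrightarrow> rank_bounded n (u \<circ> simple_refl i) ?T (F(Suc i := W))"
      using flag_refinement[OF fl i(1) aT] by blast
    have "rank_bounded n u ?I (F(Suc i := W))"
      using W(2)[OF inj(1) rank_bounded_simple_reflD[OF inj(1) r(1)]] cu by blast
    moreover have "rank_bounded n w ?T (F(Suc i := W))"
      using W(3)[OF inj(4) r(2)] ss by simp
    ultimately have "F(Suc i := W) \<in> richardson_variety n u w"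
      using W(1) richardson_variety_iff by blast
    then show ?thesis using i(2) by (intro bexI[of _ "F(Suc i := W)"]) auto
  qed
  moreover have "\<exists>F'\<in>richardson_variety n (u \<circ> ?s) (w \<circ> ?s). F' k = F k"
    if F: "F \<in> richardson_variety n u w" for F
  proof -
    have fl: "F \<in> flag_variety n" and r: "rank_bounded n u ?I F" "rank_bounded n w ?T F"
      using F richardson_variety_iff by auto
    obtain W where W: "F(Suc i := W) \<in> flag_variety n"
      "\<And>u K. inj u \<Longrightarrow> rank_bounded n u K F \<Longrightarrow> (\<And>j. u (Suc i) \<in> K j \<Longrightarrow> u i \<in> K j) \<Longrightarrow>
        rank_bounded n u K (F(Suc i := W))"
      "\<And>u. inj u \<Longrightarrow> rank_bounded n u ?I F \<Longrightarrow> rank_bounded n (u \<circ> simple_refl i) ?I (F(Suc i := W))"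
      using flag_refinement[OF fl i(1) aI] by blast
    have "rank_bounded n (w \<circ> ?s) ?T F"
    proof (rule rank_bounded_simple_reflD[OF inj(4), of n i])
      show "rank_bounded n (w \<circ> ?s \<circ> ?s) ?T F" unfolding ss by (rule r(2))
    qed (rule cw)
    then have "rank_bounded n (w \<circ> ?s) ?T (F(Suc i := W))"
      using W(2)[OF inj(4)] cw by blast
    moreover have "rank_bounded n (u \<circ> ?s) ?I (F(Suc i := W))"
      by (rule W(3)[OF inj(1) r(1)])
    ultimately have "F(Suc i := W) \<in> richardson_variety n (u \<circ> ?s) (w \<circ> ?s)"
      using W(1) richardson_variety_iff by blast
    then show ?thesis using i(2) by (intro bexI[of _ "F(Suc i := W)"]) auto
  qed
  ultimately show ?thesis
    unfolding projected_richardson_def by (intro subset_antisym image_subsetI) (metis imageI)+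
qed

section \<open>Reading a word from right to left\<close>

text \<open>A word is read from right to left. The state \<open>v\<close> is the partial product of the letters of the
  subexpression still to be read, so it starts at \<open>u\<close> and ends at the identity. The value \<open>F p\<close> is the
  image of \<open>v p\<close> under the bounded affine permutation of the bridge graph built so far.\<close>

definition token :: "nat \<Rightarrow> nat \<Rightarrow> (nat \<Rightarrow> nat) \<Rightarrow> nat \<Rightarrow> int" where
  "token k n u p = int (u p) + (if p < k then int n else 0)"

text \<open>In both rules the new state ascends at \<open>i\<close>, which is what a positive
  distinguished subexpression requires of its partial products. In both rules the larger token moves
  from left to right, so two tokens are exchanged at most once.\<close>

inductive sweep :: "nat \<Rightarrow> nat \<Rightarrow> (nat \<Rightarrow> nat) \<Rightarrow> nat list \<Rightarrow> bool list \<Rightarrow> (nat \<times> nat) list \<Rightarrow>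
    (nat \<Rightarrow> nat) \<Rightarrow> (nat \<Rightarrow> int) \<Rightarrow> bool" for k n u where
  start: "sweep k n u [] [] [] u (token k n u)"
| sort: "sweep k n u (i # wd) (True # es) bs (v \<circ> simple_refl i) (F \<circ> simple_refl i)"
    if "sweep k n u wd es bs v F" "Suc i < n" "F (Suc i) < F i" "v (Suc i) < v i"
| bridge: "sweep k n u (i # wd) (False # es) (bs @ [(v i, v (Suc i))]) v (F \<circ> simple_refl i)"
    if "sweep k n u wd es bs v F" "Suc i < n" "F (Suc i) < F i" "v i < v (Suc i)"

lemma lollipop_snoc: "lollipop (bs @ [(a, b)]) c \<longleftrightarrow> lollipop bs c \<and> c \<noteq> a \<and> c \<noteq> b"
  by (auto simp: lollipop_def)

locale sweep_start =
  fixes k n :: nat and u :: "nat \<Rightarrow> nat"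
  assumes kn: "k \<le> n" and u: "u permutes {..<n}"
begin

lemma sweep_permutes: "sweep k n u wd es bs v F \<Longrightarrow> v permutes {..<n}"
proof (induction rule: sweep.induct)
  case (sort wd es bs v F i)
  then show ?case using permutes_compose[OF permutes_simple_refl[of i n]] by blast
qed (auto intro: u)

lemma sweep_lengths:
  "sweep k n u wd es bs v F \<Longrightarrow>
    length es = length wd \<and> deodhar_dim es = length bs \<and> (\<forall>i\<in>set wd. Suc i < n)"
  by (induction rule: sweep.induct) (auto simp: deodhar_dim_def)

lemma sweep_token: "sweep k n u wd es bs v F \<Longrightarrow> F = token k n u \<circ> pinv (word_perm wd)"
proof (induction rule: sweep.induct)
  case (sort wd es bs v F i)
  have "word_perm wd permutes {..<n}" using sweep_lengths[OF sort(1)] by (intro permutes_word) simp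
  then show ?case using sort.IH by (metis comp_assoc inv_simple_refl_comp word_perm_simps(2))
next
  case (bridge wd es bs v F i)
  have "word_perm wd permutes {..<n}" using sweep_lengths[OF bridge(1)] by (intro permutes_word) simp
  then show ?case using bridge.IH by (metis comp_assoc inv_simple_refl_comp word_perm_simps(2))
qed simp

text \<open>Tokens separate lollipops from other vertices. A bridge gives its left end the token
  \<open>F (Suc i)\<close>, which is at least \<open>v (Suc i)\<close> and hence above
  \<open>v i\<close>, and which is below \<open>F i\<close> and hence below \<open>v i + n\<close>.
  The right end is symmetric, so both ends become strictly bounded.\<close>

lemma sweep_lollipop:
  "sweep k n u wd es bs v F \<Longrightarrow> p < n \<Longrightarrow>
    (if lollipop bs (v p) then F p = int (v p) + (if v p \<in> u ` {..<k} then int n else 0)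
     else int (v p) < F p \<and> F p < int (v p) + int n)"
proof (induction arbitrary: p rule: sweep.induct)
  case start
  have "u p \<in> u ` {..<k} \<longleftrightarrow> p < k" using inj_image_mem_iff[OF permutes_inj[OF u]] by simp
  then show ?case by (simp add: lollipop_def token_def)
next
  case (sort wd es bs v F i)
  then show ?case using sort.IH[of "simple_refl i p"] by (simp add: simple_refl_less)
next
  case (bridge wd es bs v F i)
  have inj: "v p = v q \<longleftrightarrow> p = q" for q
    using permutes_inj[OF sweep_permutes[OF bridge(1)]] by (simp add: inj_eq)
  have bnd: "int (v q) \<le> F q \<and> F q \<le> int (v q) + int n" if "q < n" for q
    using bridge.IH[OF that] by (auto split: if_splits)
  show ?case
  proof (cases "p = i \<or> p = Suc i")
    case True
    then have "\<not> lollipop (bs @ [(v i, v (Suc i))]) (v p)" by (auto simp: lollipop_snoc)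
    then show ?thesis using True bnd[of i] bnd[of "Suc i"] bridge(2-4) by auto
  next
    case False
    then show ?thesis
      using bridge.IH[OF bridge.prems] inj by (simp add: lollipop_snoc simple_refl_other)
  qed
qed

lemma sweep_bounds:
  assumes "sweep k n u wd es bs v F" "p < n"
  shows "int (v p) \<le> F p" "F p \<le> int (v p) + int n"
  using sweep_lollipop[OF assms] by (auto split: if_splits)

text \<open>The invariant that forces a bridge to cross only lollipops, and those in \<open>u ` {..<k}\<close> to sit on
  its left.\<close>

lemma sweep_inversion:
  "sweep k n u wd es bs v F \<Longrightarrow> p < q \<Longrightarrow> q < n \<Longrightarrow> v q < v p \<Longrightarrow>
    F p = int (v p) + int n \<or> F q = int (v q)"
proof (induction arbitrary: p q rule: sweep.induct)
  case start
  then show ?case by (auto simp: token_def)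
next
  case (sort wd es bs v F i)
  have "(p, q) \<noteq> (i, Suc i)" using sort.prems sort(4) by auto
  then have "simple_refl i p < simple_refl i q" by (rule simple_refl_mono[OF sort.prems(1)])
  then show ?case
    using sort.IH[of "simple_refl i p" "simple_refl i q"] sort.prems sort(2)
    by (simp add: simple_refl_less)
next
  case (bridge wd es bs v F i)
  let ?a = "v i" and ?b = "v (Suc i)"
  have bnd: "int (v q) \<le> F q \<and> F q \<le> int (v q) + int n" if "q < n" for q
    using sweep_bounds[OF bridge(1) that] by simp
  \<comment> \<open>\<open>F i > F (Suc i) \<ge> v (Suc i) > v i\<close>, and symmetrically for the
    other bound. In an inverted pair that contains an end of the bridge, the induction hypothesis
    therefore gives the extreme value to the other member.\<close>
  have Fi: "F i \<noteq> int ?a" and Fsi: "F (Suc i) \<noteq> int ?b + int n"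
    using bnd[of i] bnd[of "Suc i"] bridge(2-4) by auto
  have left: "F x = int (v x) + int n" if "x < i" "?a < v x" for x
    using bridge.IH[of x i] that Fi bridge(2) by auto
  have right: "F y = int (v y)" if "Suc i < y" "y < n" "v y < ?b" for y
    using bridge.IH[of "Suc i" y] that Fsi by auto
  consider "q = i \<or> q = Suc i \<and> p \<noteq> i" | "p = Suc i \<or> p = i \<and> q \<noteq> Suc i" | "p = i" "q = Suc i"
    | "p \<noteq> i" "p \<noteq> Suc i" "q \<noteq> i" "q \<noteq> Suc i" by blast
  then show ?case
  proof cases
    case 1
    then have "p < i" using bridge.prems(1) by auto
    moreover have "?a < v p" using 1 bridge.prems(3) bridge(4) by auto
    ultimately show ?thesis using left[of p] by (simp add: simple_refl_other)
  next
    case 2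
    then have "Suc i < q" using bridge.prems(1) by auto
    moreover have "v q < ?b" using 2 bridge.prems(3) bridge(4) by auto
    ultimately show ?thesis using right[of q] bridge.prems(2) by (simp add: simple_refl_other)
  next
    case 3
    then show ?thesis using bridge.prems(3) bridge(4) by simp
  next
    case 4
    then show ?thesis using bridge.IH[OF bridge.prems] by (simp add: simple_refl_other)
  qed
qed

text \<open>An intermediate value on the left forms an inversion with \<open>v i\<close>, one on the
  right with \<open>v (Suc i)\<close>. The ends of the bridge do not have the extreme tokens, so by
  \<open>sweep_inversion\<close> the intermediate value does: shifted by \<open>n\<close> on the
  left, fixed on the right.\<close>

lemma sweep_bridge_between:
  assumes "sweep k n u wd es bs v F" "Suc i < n" "F (Suc i) < F i" "v i < v (Suc i)"
    and "q < n" "v i < v q" "v q < v (Suc i)"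
  shows "lollipop bs (v q)" "v q \<in> u ` {..<k} \<longleftrightarrow> q < i"
proof -
  have bi: "F i \<noteq> int (v i)" and bsi: "F (Suc i) \<noteq> int (v (Suc i)) + int n"
    using sweep_bounds[OF assms(1), of i] sweep_bounds[OF assms(1), of "Suc i"] assms(2-4) by auto
  have "q \<noteq> i" "q \<noteq> Suc i" using assms(6,7) by auto
  then consider "q < i" | "Suc i < q" by linarith
  then have F: "(q < i \<and> F q = int (v q) + int n) \<or> (Suc i < q \<and> F q = int (v q))"
  proof cases
    case 1
    then show ?thesis using sweep_inversion[OF assms(1), of q i] assms(2,6) bi by auto
  next
    case 2
    then show ?thesis using sweep_inversion[OF assms(1), of "Suc i" q] assms(5,7) bsi by auto
  qed
  show "lollipop bs (v q)" "v q \<in> u ` {..<k} \<longleftrightarrow> q < i"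
    using F sweep_lollipop[OF assms(1,5)] assms(5) by (auto split: if_splits)
qed

end

section \<open>Bounded affine permutations as periodic extensions of their values on
  \<open>[n]\<close>\<close>

definition periodic :: "nat \<Rightarrow> (nat \<Rightarrow> int) \<Rightarrow> int \<Rightarrow> int" where
  "periodic n \<phi> i = \<phi> (nat (i mod int n)) + int n * (i div int n)"

lemma periodic_of_nat: "c < n \<Longrightarrow> periodic n \<phi> (int c) = \<phi> c"
  by (simp add: periodic_def)

lemma affine_ext_mod_div:
  assumes "0 < n" "v permutes {..<n}"
  shows "affine_ext n v i mod int n = int (v (nat (i mod int n)))"
    and "affine_ext n v i div int n = i div int n"
proof -
  have "nat (i mod int n) < n" using assms(1) by (simp add: nat_less_iff)
  then have "v (nat (i mod int n)) < n" using permutes_in_image[OF assms(2)] by blast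
  then show "affine_ext n v i mod int n = int (v (nat (i mod int n)))"
    "affine_ext n v i div int n = i div int n"
    using assms(1) by (auto simp: affine_ext_def)
qed

lemma periodic_comp_affine_ext:
  assumes "0 < n" "v permutes {..<n}"
  shows "periodic n \<phi> \<circ> affine_ext n v = periodic n (\<phi> \<circ> v)"
  using affine_ext_mod_div[OF assms] by (auto simp: periodic_def)

lemma translation_eq_periodic:
  assumes "0 < n"
  shows "translation n S = periodic n (\<lambda>x. int x + (if x \<in> S then int n else 0))"
proof
  fix i
  have "int (nat (i mod int n)) + int n * (i div int n) = i" using assms by simp
  then show "translation n S i = periodic n (\<lambda>x. int x + (if x \<in> S then int n else 0)) i"
    by (simp add: translation_def periodic_def)
qed

lemma interval_affine_perm_eq_periodic:
  assumes "0 < n" "w permutes {..<n}"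
  shows "interval_affine_perm k n u w = periodic n (token k n u \<circ> pinv w)"
proof
  fix i
  let ?x = "pinv w (nat (i mod int n))" and ?q = "i div int n"
  let ?i = "affine_ext n (pinv w) i"
  have md: "?i mod int n = int ?x" "?i div int n = ?q"
    using affine_ext_mod_div[OF assms(1) permutes_inv[OF assms(2)]] by auto
  then show "interval_affine_perm k n u w i = periodic n (token k n u \<circ> pinv w) i"
    using assms(1)
    by (auto simp: interval_affine_perm_def translation_def periodic_def token_def affine_ext_def[of n u]
      algebra_simps)
qed

text \<open>The effect of the two rules of \<open>sweep\<close> on \<open>F \<circ> pinv v\<close>:
  sorting leaves it unchanged, a bridge composes it with the transposition of the two ends.\<close>

lemma comp_simple_refl_pinv:
  assumes "v permutes {..<n}"
  shows "F \<circ> simple_refl i \<circ> pinv (v \<circ> simple_refl i) = F \<circ> pinv v"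
    and "F \<circ> simple_refl i \<circ> pinv v = F \<circ> pinv v \<circ> transpose (v i) (v (Suc i))"
proof -
  have bij: "bij v" using permutes_bij[OF assms] .
  have "pinv (v \<circ> simple_refl i) = simple_refl i \<circ> pinv v"
    using bij by (intro inv_unique_comp) (auto simp: fun_eq_iff bij_is_inj bij_is_surj surj_f_inv_f)
  then show "F \<circ> simple_refl i \<circ> pinv (v \<circ> simple_refl i) = F \<circ> pinv v"
    by (simp add: fun_eq_iff)
  have "simple_refl i (pinv v x) = pinv v (transpose (v i) (v (Suc i)) x)" for x
  proof -
    have e: "pinv v x = c \<longleftrightarrow> x = v c" for c using permutes_inverses[OF assms] by auto
    have "simple_refl i (pinv v x) = (if x = v i then Suc i else if x = v (Suc i) then i else pinv v x)"
      unfolding simple_refl_def transpose_def e ..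
    then show ?thesis by (auto simp: transpose_def permutes_inverses[OF assms])
  qed
  then show "F \<circ> simple_refl i \<circ> pinv v = F \<circ> pinv v \<circ> transpose (v i) (v (Suc i))"
    by (simp add: fun_eq_iff)
qed

context sweep_start begin

lemma translation_eq_token:
  assumes "0 < n"
  shows "translation n (u ` {..<k}) = periodic n (token k n u \<circ> pinv u)"
proof -
  have "token k n u (pinv u x) = int x + (if x \<in> u ` {..<k} then int n else 0)" for x
  proof -
    have "x \<in> u ` {..<k} \<longleftrightarrow> pinv u x < k"
      using inj_image_mem_iff[OF permutes_inj[OF u], of "pinv u x" "{..<k}"]
      by (simp add: permutes_inverses[OF u])
    then show ?thesis by (simp add: token_def permutes_inverses[OF u])
  qed
  then show ?thesis
    using translation_eq_periodic[OF assms, of "u ` {..<k}"] by (simp add: comp_def)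
qed

lemma sweep_bridge_graph:
  assumes "0 < n"
  shows "sweep k n u wd es bs v F \<Longrightarrow> bridge_graph k n (u ` {..<k}) bs (periodic n (F \<circ> pinv v))"
proof (induction rule: sweep.induct)
  case start
  have inj: "inj u" by (rule permutes_inj[OF u])
  note translation_eq_token[OF assms]
  moreover have "u ` {..<k} \<subseteq> {..<n}" using permutes_image[OF u] kn by auto
  moreover have "card (u ` {..<k}) = k" using inj by (simp add: card_image inj_on_subset)
  ultimately show ?case using bridge_graph.lollipops[of "u ` {..<k}" n k] by metis
next
  case (sort wd es bs v F i)
  then show ?case
    using comp_simple_refl_pinv(1)[OF sweep_permutes[OF sort(1)]] by metis
next
  case (bridge wd es bs v F i)
  let ?a = "v i" and ?b = "v (Suc i)"
  have v: "v permutes {..<n}" using sweep_permutes[OF bridge(1)] .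
  have lt: "?b < n" using permutes_in_image[OF v] bridge(2) by simp
  have p: "transpose ?a ?b permutes {..<n}" using lt bridge(4) by (intro permutes_swap_id) auto
  have eq: "periodic n (F \<circ> simple_refl i \<circ> pinv v) =
      periodic n (F \<circ> pinv v) \<circ> affine_ext n (transpose ?a ?b)"
    unfolding periodic_comp_affine_ext[OF assms p] comp_simple_refl_pinv(2)[OF v] ..
  show ?case unfolding eq
  proof (rule bridge_graph.add_bridge[OF bridge.IH bridge(4) lt])
    show "periodic n (F \<circ> pinv v) (int ?b) < periodic n (F \<circ> pinv v) (int ?a)"
      using lt bridge(3,4) by (simp add: periodic_of_nat permutes_inverses[OF v])
    show "\<forall>c\<in>{?a<..<?b}. lollipop bs c"
    proof
      fix c assume c: "c \<in> {?a<..<?b}"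
      then have "pinv v c < n" using permutes_in_image[OF permutes_inv[OF v]] lt by auto
      then show "lollipop bs c"
        using sweep_bridge_between(1)[OF bridge(1-4), of "pinv v c"] c
        by (simp add: permutes_inverses[OF v])
    qed
  qed
qed

end

section \<open>Comparison of the matrices\<close>

text \<open>The matrix of \<open>v\<close> below is the inverse of the lift of \<open>v\<close> to the normalizer of the torus.\<close>

definition inversion_sign :: "(nat \<Rightarrow> nat) \<Rightarrow> nat \<Rightarrow> complex" where
  "inversion_sign v i = (- 1) ^ card {p. p < i \<and> v i < v p}"

definition signed_perm_mat :: "nat \<Rightarrow> (nat \<Rightarrow> nat) \<Rightarrow> complex mat" where
  "signed_perm_mat n v = mat n n (\<lambda>(i, j). if j = v i then inversion_sign v i else 0)"

lemma inversion_sign_square: "inversion_sign v i * inversion_sign v i = 1"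
  by (simp add: inversion_sign_def flip: power_add mult_2)

lemma signed_perm_mat_carrier [simp]: "signed_perm_mat n v \<in> carrier_mat n n"
  by (simp add: signed_perm_mat_def)

lemma refl_lift_inv_carrier [simp]: "refl_lift_inv n i \<in> carrier_mat n n"
  by (simp add: refl_lift_inv_def)

lemma signed_perm_mat_id: "signed_perm_mat n id = 1\<^sub>m n"
  unfolding signed_perm_mat_def
proof (rule eq_matI)
  fix i j assume ij: "i < dim_row (1\<^sub>m n :: complex mat)" "j < dim_col (1\<^sub>m n :: complex mat)"
  have "{p. p < i \<and> id i < id p} = {}" by auto
  then have "inversion_sign id i = 1" unfolding inversion_sign_def by (metis card.empty power_0)
  then show "mat n n (\<lambda>(i, j). if j = id i then inversion_sign id i else 0) $$ (i, j) = 1\<^sub>m n $$ (i, j)"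
    using ij by auto
qed auto

text \<open>An inversion is counted at its right entry. Sorting a descent removes one inversion, so
  only the sign of the smaller value flips; this is the entry \<open>- 1\<close> of
  \<open>refl_lift_inv\<close>.\<close>

lemma inversion_sign_descent:
  assumes "v (Suc i) < v i"
  shows "inversion_sign (v \<circ> simple_refl i) (Suc i) = inversion_sign v i"
    and "inversion_sign (v \<circ> simple_refl i) i = - inversion_sign v (Suc i)"
    and "p \<noteq> i \<Longrightarrow> p \<noteq> Suc i \<Longrightarrow> inversion_sign (v \<circ> simple_refl i) p = inversion_sign v p"
proof -
  let ?s = "simple_refl i"
  have "{p. p < Suc i \<and> (v \<circ> ?s) (Suc i) < (v \<circ> ?s) p} = {p. p < i \<and> v i < v p}"
    using assms by (auto simp: less_Suc_eq simple_refl_other)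
  then show "inversion_sign (v \<circ> ?s) (Suc i) = inversion_sign v i"
    unfolding inversion_sign_def by metis
  have "{p. p < Suc i \<and> v (Suc i) < v p} = insert i {p. p < i \<and> (v \<circ> ?s) i < (v \<circ> ?s) p}"
    using assms by (auto simp: less_Suc_eq simple_refl_other)
  moreover have "finite {p. p < i \<and> (v \<circ> ?s) i < (v \<circ> ?s) p}" by simp
  ultimately have "card {p. p < Suc i \<and> v (Suc i) < v p} = Suc (card {p. p < i \<and> (v \<circ> ?s) i < (v \<circ> ?s) p})"
    by (metis (no_types, lifting) card_insert_disjoint less_irrefl mem_Collect_eq)
  then show "inversion_sign (v \<circ> ?s) i = - inversion_sign v (Suc i)"
    unfolding inversion_sign_def by simp
  assume p: "p \<noteq> i" "p \<noteq> Suc i"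
  have lt: "?s x < p \<longleftrightarrow> x < p" for x
    using p by (auto simp: simple_refl_def transpose_def)
  have "bij_betw ?s {x. x < p \<and> (v \<circ> ?s) p < (v \<circ> ?s) x} {x. x < p \<and> v p < v x}"
    by (rule bij_betw_byWitness[where f' = ?s]) (auto simp: lt simple_refl_other p)
  then have "card {x. x < p \<and> (v \<circ> ?s) p < (v \<circ> ?s) x} = card {x. x < p \<and> v p < v x}"
    by (rule bij_betw_same_card)
  then show "inversion_sign (v \<circ> ?s) p = inversion_sign v p"
    unfolding inversion_sign_def by simp
qed

lemma row_refl_lift_inv:
  assumes "Suc i < n" "p < n"
  shows "row (refl_lift_inv n i) p =
    (if p = i then unit_vec n (Suc i) else if p = Suc i then (- 1) \<cdot>\<^sub>v unit_vec n i else unit_vec n p)"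
  using assms by (intro eq_vecI) (auto simp: refl_lift_inv_def)

lemma refl_lift_inv_mult_signed_perm_mat:
  assumes "v permutes {..<n}" "Suc i < n" "v (Suc i) < v i"
  shows "refl_lift_inv n i * signed_perm_mat n (v \<circ> simple_refl i) = signed_perm_mat n v"
proof (rule eq_matI)
  fix p q assume "p < dim_row (signed_perm_mat n v)" "q < dim_col (signed_perm_mat n v)"
  then have pq: "p < n" "q < n" by (auto simp: signed_perm_mat_def)
  let ?D = "signed_perm_mat n (v \<circ> simple_refl i)"
  have c: "col ?D q \<in> carrier_vec n" by (simp add: signed_perm_mat_def carrier_vecI)
  have "(refl_lift_inv n i * ?D) $$ (p, q) = row (refl_lift_inv n i) p \<bullet> col ?D q"
    using pq by (simp add: refl_lift_inv_def signed_perm_mat_def)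
  also have "\<dots> = (if p = i then ?D $$ (Suc i, q) else if p = Suc i then - ?D $$ (i, q) else ?D $$ (p, q))"
    unfolding row_refl_lift_inv[OF assms(2) pq(1)]
    using pq assms(2) c by (simp add: scalar_prod_left_unit signed_perm_mat_def)
  also have "\<dots> = signed_perm_mat n v $$ (p, q)"
    using pq assms(2) inversion_sign_descent[of v i, OF assms(3)]
    by (auto simp: signed_perm_mat_def simple_refl_other)
  finally show "(refl_lift_inv n i * ?D) $$ (p, q) = signed_perm_mat n v $$ (p, q)" .
qed (auto simp: signed_perm_mat_def refl_lift_inv_def)

text \<open>A row operation on a signed permutation matrix is a column operation on the
  corresponding columns, up to the product of the two signs.\<close>

lemma addrow_mat_mult_signed_perm_mat:
  assumes "v permutes {..<n}" "Suc i < n"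
  shows "addrow_mat n t i (Suc i) * signed_perm_mat n v =
    signed_perm_mat n v * addrow_mat n (inversion_sign v i * inversion_sign v (Suc i) * t) (v i) (v (Suc i))"
proof -
  let ?D = "signed_perm_mat n v" and ?t = "inversion_sign v i * inversion_sign v (Suc i) * t"
  have lt: "v p < n" if "p < n" for p using permutes_in_image[OF assms(1)] that by simp
  have inj: "v p = v q \<longleftrightarrow> p = q" for p q using permutes_inj[OF assms(1)] by (simp add: inj_eq)
  have sq: "inversion_sign v i * (inversion_sign v i * x) = x" for x
    using inversion_sign_square[of v i] by (simp flip: mult.assoc)
  have "addrow_mat n t i (Suc i) * ?D = addrow t i (Suc i) ?D"
    using addrow_mat[of ?D n n "Suc i" t i] assms(2) by simp
  also have "\<dots> = addcol ?t (v (Suc i)) (v i) ?D"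
  proof (rule eq_matI)
    fix p q assume "p < dim_row (addcol ?t (v (Suc i)) (v i) ?D)" "q < dim_col (addcol ?t (v (Suc i)) (v i) ?D)"
    then have pq: "p < n" "q < n" by (auto simp: signed_perm_mat_def)
    have "?t * inversion_sign v i = t * inversion_sign v (Suc i)"
      using sq[of "t * inversion_sign v (Suc i)"] by (simp add: mult.commute mult.left_commute)
    then show "addrow t i (Suc i) ?D $$ (p, q) = addcol ?t (v (Suc i)) (v i) ?D $$ (p, q)"
      using pq assms(2) lt[of i] lt[of "Suc i"] by (auto simp: signed_perm_mat_def inj)
  qed (auto simp: signed_perm_mat_def)
  also have "\<dots> = ?D * addrow_mat n ?t (v i) (v (Suc i))"
    using addcol_mat[of ?D n n "v i" ?t "v (Suc i)"] lt[of i] assms(2) by simp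
  finally show ?thesis .
qed

lemma prod_mat_carrier:
  "\<forall>A\<in>set As. A \<in> carrier_mat n n \<Longrightarrow> prod_mat n As \<in> carrier_mat n n"
  by (induction As) (auto simp: prod_mat_def)

lemma prod_mat_snoc:
  assumes "\<forall>A\<in>set As. A \<in> carrier_mat n n" "B \<in> carrier_mat n n"
  shows "prod_mat n (As @ [B]) = prod_mat n As * B"
  using assms(1)
proof (induction As)
  case Nil
  then show ?case using assms(2) by (simp add: prod_mat_def)
next
  case (Cons A As)
  then have "prod_mat n As \<in> carrier_mat n n" by (intro prod_mat_carrier) simp
  then show ?case using Cons assms(2) by (simp add: prod_mat_def assoc_mult_mat[of _ n n _ n _ n])
qed

lemma deodhar_factor_carrier: "deodhar_factor n wd es ts j \<in> carrier_mat n n"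
  by (simp add: deodhar_factor_def)

lemma deodhar_mat_Cons:
  assumes "length es = length wd"
  shows "deodhar_mat n (i # wd) (e # es) ts = deodhar_mat n wd es ts *
    (if e then refl_lift_inv n i else addrow_mat n (ts ! deodhar_dim es) i (Suc i))"
proof -
  let ?f = "deodhar_factor n (i # wd) (e # es) ts"
  have "?f (Suc j) = deodhar_factor n wd es ts j" if "j < length wd" for j
  proof -
    have "{l. Suc j < l \<and> l < length (i # wd) \<and> \<not> (e # es) ! l} =
        Suc ` {l. j < l \<and> l < length wd \<and> \<not> es ! l}"
      by (auto simp: image_iff gr0_conv_Suc Suc_less_eq2)
    then show ?thesis by (simp add: deodhar_factor_def card_image)
  qed
  moreover have "rev [0..<length (i # wd)] = map Suc (rev [0..<length wd]) @ [0]"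
    by (simp add: upt_conv_Cons rev_map[symmetric] map_Suc_upt del: upt_Suc)
  ultimately have "map ?f (rev [0..<length (i # wd)]) =
      map (deodhar_factor n wd es ts) (rev [0..<length wd]) @ [?f 0]"
    by simp
  then have "deodhar_mat n (i # wd) (e # es) ts = deodhar_mat n wd es ts * ?f 0"
    using prod_mat_snoc[of "map (deodhar_factor n wd es ts) (rev [0..<length wd])" n "?f 0"]
    unfolding deodhar_mat_def by (simp add: deodhar_factor_carrier del: upt_Suc)
  moreover have "{l. 0 < l \<and> l < length (i # wd) \<and> \<not> (e # es) ! l} =
      Suc ` {l. l < length es \<and> \<not> es ! l}"
    using assms by (auto simp: image_iff gr0_conv_Suc)
  then have "card {l. 0 < l \<and> l < length (i # wd) \<and> \<not> (e # es) ! l} = deodhar_dim es"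
    by (simp add: card_image deodhar_dim_def length_filter_conv_card)
  ultimately show ?thesis by (simp only: deodhar_factor_def nth_Cons_0)
qed

context sweep_start begin

text \<open>Entries to the left of \<open>i\<close> that exceed \<open>v (Suc i)\<close> are counted
  in both signs and cancel. There remain the intermediate values on the left, which by
  \<open>sweep_bridge_between\<close> are exactly the elements of the initial subset under the
  bridge.\<close>

lemma sweep_bridge_sign:
  assumes "sweep k n u wd es bs v F" "Suc i < n" "F (Suc i) < F i" "v i < v (Suc i)"
  shows "inversion_sign v i * inversion_sign v (Suc i) = bridge_sign (u ` {..<k}) (v i) (v (Suc i))"
proof -
  let ?a = "v i" and ?b = "v (Suc i)"
  let ?M = "{p. p < i \<and> ?a < v p \<and> v p < ?b}" and ?B = "{p. p < i \<and> ?b < v p}"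
  have v: "v permutes {..<n}" using sweep_permutes[OF assms(1)] .
  have inj: "inj v" using permutes_inj[OF v] .
  have 1: "{p. p < i \<and> ?a < v p} = ?M \<union> ?B"
    using assms(4) inj_eq[OF inj] by (auto simp: not_less_iff_gr_or_eq)
  have 2: "{p. p < Suc i \<and> ?b < v p} = ?B" using assms(4) by (auto simp: less_Suc_eq)
  have "card (?M \<union> ?B) = card ?M + card ?B" by (intro card_Un_disjoint) auto
  then have "inversion_sign v i * inversion_sign v (Suc i) = (- 1) ^ (card ?M + card ?B + card ?B)"
    unfolding inversion_sign_def 1 2 by (simp add: power_add)
  also have "\<dots> = (- 1) ^ card ?M" by (simp add: power_add flip: power_mult_distrib)
  also have "card ?M = card (u ` {..<k} \<inter> {?a<..<?b})"
  proof -
    have "u ` {..<k} \<inter> {?a<..<?b} = v ` ?M"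
    proof (intro equalityI subsetI)
      fix c assume c: "c \<in> u ` {..<k} \<inter> {?a<..<?b}"
      have "c < n" using c permutes_in_image[OF v, of "Suc i"] assms(2) by auto
      then have "pinv v c < n" using permutes_in_image[OF permutes_inv[OF v]] by simp
      then have "pinv v c < i"
        using sweep_bridge_between(2)[OF assms, of "pinv v c"] c by (simp add: permutes_inverses[OF v])
      then show "c \<in> v ` ?M"
        using c by (intro image_eqI[of _ _ "pinv v c"]) (auto simp: permutes_inverses[OF v])
    next
      fix c assume "c \<in> v ` ?M"
      then obtain p where "p < i" "?a < v p" "v p < ?b" "c = v p" by blast
      then show "c \<in> u ` {..<k} \<inter> {?a<..<?b}"
        using sweep_bridge_between(2)[OF assms, of p] assms(2) by auto
    qed
    then show ?thesis using inj by (simp add: card_image inj_on_subset)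
  qed
  finally show ?thesis by (simp add: bridge_sign_def)
qed

lemma sweep_matrix:
  "sweep k n u wd es bs v F \<Longrightarrow> length bs \<le> length ts \<Longrightarrow>
    deodhar_mat n wd es ts * signed_perm_mat n v = signed_perm_mat n u *
      prod_mat n (map2 (\<lambda>(a, b) t. addrow_mat n (bridge_sign (u ` {..<k}) a b * t) a b) bs ts)"
proof (induction rule: sweep.induct)
  case start
  then show ?case
    by (simp add: deodhar_mat_def prod_mat_def left_mult_one_mat[of _ n n] right_mult_one_mat[of _ n n])
next
  case (sort wd es bs v F i)
  have v: "v permutes {..<n}" using sweep_permutes[OF sort(1)] .
  have D: "deodhar_mat n wd es ts \<in> carrier_mat n n"
    unfolding deodhar_mat_def by (intro prod_mat_carrier) (auto simp: deodhar_factor_carrier)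
  have "length es = length wd" using sweep_lengths[OF sort(1)] by simp
  then have "deodhar_mat n (i # wd) (True # es) ts * signed_perm_mat n (v \<circ> simple_refl i) =
      deodhar_mat n wd es ts * (refl_lift_inv n i * signed_perm_mat n (v \<circ> simple_refl i))"
    using D by (simp add: deodhar_mat_Cons assoc_mult_mat[of _ n n _ n _ n])
  also have "\<dots> = deodhar_mat n wd es ts * signed_perm_mat n v"
    unfolding refl_lift_inv_mult_signed_perm_mat[OF v sort(2,4)] ..
  also note sort.IH[OF sort.prems]
  finally show ?case .
next
  case (bridge wd es bs v F i)
  let ?g = "\<lambda>(a, b) t. addrow_mat n (bridge_sign (u ` {..<k}) a b * t) a b"
  let ?t = "ts ! length bs"
  have v: "v permutes {..<n}" using sweep_permutes[OF bridge(1)] .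
  have D: "deodhar_mat n wd es ts \<in> carrier_mat n n"
    unfolding deodhar_mat_def by (intro prod_mat_carrier) (auto simp: deodhar_factor_carrier)
  have P: "prod_mat n (map2 ?g bs ts) \<in> carrier_mat n n"
    by (intro prod_mat_carrier) auto
  have len: "length es = length wd" "deodhar_dim es = length bs"
    using sweep_lengths[OF bridge(1)] by auto
  let ?x = "addrow_mat n (bridge_sign (u ` {..<k}) (v i) (v (Suc i)) * ?t) (v i) (v (Suc i))"
  \<comment> \<open>The full list \<open>ts\<close> is kept throughout the induction, so it may be
    longer than \<open>bs\<close>; \<open>zip\<close> cuts it off, and the new bridge picks up the
    entry at index \<open>length bs\<close>.\<close>
  have "zip bs (take (length bs) ts) = zip bs ts"
    using take_zip[of "length bs" bs ts] by simp
  moreover have "drop (length bs) ts = ?t # drop (Suc (length bs)) ts"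
    using bridge.prems by (simp add: Cons_nth_drop_Suc)
  ultimately have "zip (bs @ [(v i, v (Suc i))]) ts = zip bs ts @ [((v i, v (Suc i)), ?t)]"
    by (simp add: zip_append1)
  then have split: "map2 ?g (bs @ [(v i, v (Suc i))]) ts = map2 ?g bs ts @ [?x]"
    by simp
  have "deodhar_mat n (i # wd) (False # es) ts * signed_perm_mat n v =
      deodhar_mat n wd es ts * (addrow_mat n ?t i (Suc i) * signed_perm_mat n v)"
    using D by (simp add: deodhar_mat_Cons len assoc_mult_mat[of _ n n _ n _ n])
  also have "\<dots> = deodhar_mat n wd es ts * (signed_perm_mat n v * ?x)"
    unfolding addrow_mat_mult_signed_perm_mat[OF v bridge(2)] sweep_bridge_sign[OF bridge(1-4)] ..
  also have "\<dots> = deodhar_mat n wd es ts * signed_perm_mat n v * ?x"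
    using D by (simp add: assoc_mult_mat[of _ n n _ n _ n])
  also have "\<dots> = signed_perm_mat n u * prod_mat n (map2 ?g bs ts) * ?x"
    using bridge.IH bridge.prems by simp
  also have "\<dots> = signed_perm_mat n u * (prod_mat n (map2 ?g bs ts) * ?x)"
    using P by (simp add: assoc_mult_mat[of _ n n _ n _ n])
  also have "prod_mat n (map2 ?g bs ts) * ?x = prod_mat n (map2 ?g (bs @ [(v i, v (Suc i))]) ts)"
    unfolding split by (rule prod_mat_snoc[symmetric]) auto
  finally show ?case .
qed

text \<open>The first \<open>k\<close> rows of the signed permutation matrix are those of
  \<open>subset_mat\<close>, permuted and with signs. This is multiplication by a signed permutation
  matrix \<open>C\<close> of size \<open>k\<close>, whose inverse is its transpose.\<close>

lemma row_space_signed_perm_mat: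
  assumes Q: "Q \<in> carrier_mat n n"
  shows "vec_space.row_space n (mat_of_rows n (take k (rows (signed_perm_mat n u * Q)))) =
    vec_space.row_space n (subset_mat k n (u ` {..<k}) * Q)"
proof -
  let ?S = "u ` {..<k}"
  let ?xs = "sorted_list_of_set ?S"
  have inj: "inj u" by (rule permutes_inj[OF u])
  have card: "length ?xs = k" using inj by (simp add: card_image inj_on_subset)
  have dist: "distinct ?xs" and set: "set ?xs = ?S" by auto
  define C where "C = mat k k (\<lambda>(i, l). if u i = ?xs ! l then inversion_sign u i else 0)"
  have C: "C \<in> carrier_mat k k" by (simp add: C_def)
  have S: "subset_mat k n ?S \<in> carrier_mat k n" by (simp add: subset_mat_def)
  have idx: "\<exists>l<k. u i = ?xs ! l" if "i < k" for i
    using that set card by (metis image_eqI in_set_conv_nth lessThan_iff)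
  have one: "(\<Sum>l<k. (if u i = ?xs ! l then f l else 0) ) = f m"
    if "m < k" "u i = ?xs ! m" for i m and f :: "nat \<Rightarrow> complex"
  proof -
    have "u i = ?xs ! l \<longleftrightarrow> l = m" if "l < k" for l
      using that \<open>m < k\<close> \<open>u i = ?xs ! m\<close> dist card by (metis nth_eq_iff_index_eq)
    then have "(\<Sum>l<k. (if u i = ?xs ! l then f l else 0)) = (\<Sum>l<k. (if l = m then f l else 0))"
      by (intro sum.cong) auto
    then show ?thesis using that by simp
  qed
  have "C * C\<^sup>T = 1\<^sub>m k"
  proof (rule eq_matI)
    fix i j assume "i < dim_row (1\<^sub>m k :: complex mat)" "j < dim_col (1\<^sub>m k :: complex mat)"
    then have ij: "i < k" "j < k" by auto
    obtain m where m: "m < k" "u i = ?xs ! m" using idx[OF ij(1)] by blast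
    have "(C * C\<^sup>T) $$ (i, j) = (\<Sum>l<k. C $$ (i, l) * C $$ (j, l))"
      using ij C by (simp add: scalar_prod_def atLeast0LessThan)
    also have "\<dots> = (\<Sum>l<k. (if u i = ?xs ! l then inversion_sign u i * C $$ (j, l) else 0))"
      using ij by (intro sum.cong) (auto simp: C_def)
    also have "\<dots> = inversion_sign u i * C $$ (j, m)" by (rule one[OF m])
    also have "\<dots> = 1\<^sub>m k $$ (i, j)"
      using ij m inversion_sign_square[of u i] injD[OF inj, of i j] by (auto simp: C_def)
    finally show "(C * C\<^sup>T) $$ (i, j) = 1\<^sub>m k $$ (i, j)" .
  qed (auto simp: C_def)
  then have inv: "invertible_mat C"
    using mat_mult_left_right_inverse[of C k "C\<^sup>T"] C
    unfolding invertible_mat_def inverts_mat_def by (auto intro!: exI[of _ "C\<^sup>T"])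
  have "mat_of_rows n (take k (rows (signed_perm_mat n u * Q))) = C * (subset_mat k n ?S * Q)"
  proof -
    have CS: "C * subset_mat k n ?S = mat k n (\<lambda>(i, j). signed_perm_mat n u $$ (i, j))"
    proof (rule eq_matI)
      fix i j assume "i < dim_row (mat k n (\<lambda>(i, j). signed_perm_mat n u $$ (i, j)))"
        "j < dim_col (mat k n (\<lambda>(i, j). signed_perm_mat n u $$ (i, j)))"
      then have ij: "i < k" "j < n" by auto
      obtain m where m: "m < k" "u i = ?xs ! m" using idx[OF ij(1)] by blast
      have "(C * subset_mat k n ?S) $$ (i, j) = (\<Sum>l<k. C $$ (i, l) * subset_mat k n ?S $$ (l, j))"
        using ij C S by (simp add: scalar_prod_def atLeast0LessThan)
      also have "\<dots> = (\<Sum>l<k. (if u i = ?xs ! l then inversion_sign u i * subset_mat k n ?S $$ (l, j) else 0))"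
        using ij by (intro sum.cong) (auto simp: C_def)
      also have "\<dots> = inversion_sign u i * subset_mat k n ?S $$ (m, j)" by (rule one[OF m])
      also have "\<dots> = signed_perm_mat n u $$ (i, j)"
        using ij m kn by (simp add: subset_mat_def signed_perm_mat_def)
      finally show "(C * subset_mat k n ?S) $$ (i, j) = mat k n (\<lambda>(i, j). signed_perm_mat n u $$ (i, j)) $$ (i, j)"
        using ij by simp
    qed (use C S in auto)
    have "C * (subset_mat k n ?S * Q) = mat k n (\<lambda>(i, j). signed_perm_mat n u $$ (i, j)) * Q"
      using assoc_mult_mat[OF C S Q] CS by simp
    also have "\<dots> = mat_of_rows n (take k (rows (signed_perm_mat n u * Q)))"
    proof (rule eq_matI)
      fix i j assume "i < dim_row (mat_of_rows n (take k (rows (signed_perm_mat n u * Q))))"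
        "j < dim_col (mat_of_rows n (take k (rows (signed_perm_mat n u * Q))))"
      then have ij: "i < k" "j < n" using kn by (auto simp: signed_perm_mat_def)
      have "row (mat k n (\<lambda>(i, j). signed_perm_mat n u $$ (i, j))) i = row (signed_perm_mat n u) i"
        using ij kn by (intro eq_vecI) (auto simp: signed_perm_mat_def)
      then show "(mat k n (\<lambda>(i, j). signed_perm_mat n u $$ (i, j)) * Q) $$ (i, j) =
          mat_of_rows n (take k (rows (signed_perm_mat n u * Q))) $$ (i, j)"
        using ij kn Q by (simp add: mat_of_rows_index signed_perm_mat_def)
    qed (use Q kn in \<open>auto simp: signed_perm_mat_def\<close>)
    finally show ?thesis by simp
  qed
  then show ?thesis
    using vec_space.row_space_is_preserved[OF inv C mult_carrier_mat[OF S Q]] by simp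
qed

lemma sweep_param:
  assumes "sweep k n u wd es bs id F" "length ts = length bs"
  shows "deodhar_param k n wd es ts = bridge_param k n (u ` {..<k}) bs ts"
proof -
  let ?P = "prod_mat n (map2 (\<lambda>(a, b) t. addrow_mat n (bridge_sign (u ` {..<k}) a b * t) a b) bs ts)"
  have D: "deodhar_mat n wd es ts \<in> carrier_mat n n"
    unfolding deodhar_mat_def by (intro prod_mat_carrier) (auto simp: deodhar_factor_carrier)
  have "deodhar_mat n wd es ts = signed_perm_mat n u * ?P"
    using sweep_matrix[OF assms(1), of ts] assms(2) D by (simp add: signed_perm_mat_id)
  moreover have "?P \<in> carrier_mat n n" by (intro prod_mat_carrier) auto
  ultimately show ?thesis
    unfolding deodhar_param_def bridge_param_def using row_space_signed_perm_mat by simp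
qed

end

section \<open>From Deodhar parametrizations to bridge graphs\<close>

lemma foldr_comp_snoc: "foldr (\<circ>) (fs @ [g]) id = foldr (\<circ>) fs id \<circ> g"
  by (induction fs) (auto simp: comp_assoc)

lemma partial_prod_0 [simp]: "partial_prod wd es 0 = id"
  by (simp add: partial_prod_def)

lemma partial_prod_Suc:
  assumes "j < length wd" "length es = length wd"
  shows "partial_prod wd es (Suc j) = partial_prod wd es j \<circ> (if es ! j then simple_refl (wd ! j) else id)"
proof -
  let ?g = "\<lambda>i e. if e then simple_refl i else id"
  have "map2 ?g (take (Suc j) wd) (take (Suc j) es) = map2 ?g (take j wd) (take j es) @ [?g (wd ! j) (es ! j)]"
    using assms by (simp add: take_Suc_conv_app_nth)
  then show ?thesis unfolding partial_prod_def by (simp only: foldr_comp_snoc)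
qed

lemma partial_prod_Cons:
  "partial_prod (i # wd) (e # es) (Suc j) = (if e then simple_refl i else id) \<circ> partial_prod wd es j"
  by (simp add: partial_prod_def)

lemma partial_prod_permutes:
  assumes "\<forall>i\<in>set wd. Suc i < n" "length es = length wd"
  shows "j \<le> length wd \<Longrightarrow> partial_prod wd es j permutes {..<n}"
proof (induction j)
  case (Suc j)
  have "(if es ! j then simple_refl (wd ! j) else id) permutes {..<n}"
    using permutes_simple_refl[of "wd ! j" n] permutes_id assms(1) Suc.prems by auto
  from permutes_compose[OF this Suc.IH] show ?case
    using partial_prod_Suc[of j wd es] assms(2) Suc.prems by (metis Suc_leD Suc_le_lessD)
qed (simp add: permutes_id)

lemma bruhat_le_refl: "v permutes {..<n} \<Longrightarrow> bruhat_le n v v"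
  by (simp add: bruhat_le_def)

lemma positive_distinguished_iff:
  assumes "\<forall>i\<in>set wd. Suc i < n" "length es = length wd"
  shows "positive_distinguished n wd es u \<longleftrightarrow> partial_prod wd es (length wd) = u \<and>
    (\<forall>j<length wd. partial_prod wd es j (wd ! j) < partial_prod wd es j (Suc (wd ! j)))"
proof -
  have "bruhat_le n (partial_prod wd es (Suc j)) (partial_prod wd es j \<circ> simple_refl (wd ! j)) \<and>
      bruhat_le n (partial_prod wd es j) (partial_prod wd es (Suc j)) \<longleftrightarrow>
      partial_prod wd es j (wd ! j) < partial_prod wd es j (Suc (wd ! j))" if j: "j < length wd" for j
  proof -
    let ?v = "partial_prod wd es j"
    have v: "?v permutes {..<n}" using partial_prod_permutes[OF assms] j by simp
    have i: "Suc (wd ! j) < n" using assms(1) j by simp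
    have vs: "?v \<circ> simple_refl (wd ! j) permutes {..<n}"
      by (rule permutes_compose[OF permutes_simple_refl[OF i] v])
    show ?thesis
      using bruhat_le_simple_refl_iff[OF v i] bruhat_le_refl[OF v] bruhat_le_refl[OF vs]
      unfolding partial_prod_Suc[OF j assms(2)] by (cases "es ! j") auto
  qed
  then show ?thesis
    unfolding positive_distinguished_def distinguished_def using assms(2) by blast
qed

context sweep_start begin

text \<open>Stated relative to the state \<open>v\<close>, so that letters can be put in front of
  the word; at \<open>v = id\<close> it is the condition of
  \<open>positive_distinguished_iff\<close>.\<close>

lemma sweep_partial_prod:
  "sweep k n u wd es bs v F \<Longrightarrow> v \<circ> partial_prod wd es (length wd) = u \<and>
    (\<forall>j<length wd. (v \<circ> partial_prod wd es j) (wd ! j) < (v \<circ> partial_prod wd es j) (Suc (wd ! j)))"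
proof (induction rule: sweep.induct)
  case (sort wd es bs v F i)
  have eq: "v \<circ> simple_refl i \<circ> partial_prod (i # wd) (True # es) (Suc j) = v \<circ> partial_prod wd es j" for j
    by (simp add: partial_prod_Cons fun_eq_iff)
  have "(v \<circ> simple_refl i \<circ> partial_prod (i # wd) (True # es) j) ((i # wd) ! j) <
      (v \<circ> simple_refl i \<circ> partial_prod (i # wd) (True # es) j) (Suc ((i # wd) ! j))"
    if "j < length (i # wd)" for j
  proof (cases j)
    case 0
    then show ?thesis using sort(4) by simp
  next
    case (Suc j')
    then show ?thesis using sort.IH that unfolding Suc eq by simp
  qed
  then show ?case using sort.IH eq[of "length wd"] by (metis length_Cons)
next
  case (bridge wd es bs v F i)
  have eq: "partial_prod (i # wd) (False # es) (Suc j) = partial_prod wd es j" for j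
    by (simp add: partial_prod_Cons)
  have "(v \<circ> partial_prod (i # wd) (False # es) j) ((i # wd) ! j) <
      (v \<circ> partial_prod (i # wd) (False # es) j) (Suc ((i # wd) ! j))"
    if "j < length (i # wd)" for j
  proof (cases j)
    case 0
    then show ?thesis using bridge(4) by simp
  next
    case (Suc j')
    then show ?thesis using bridge.IH that unfolding Suc eq by simp
  qed
  then show ?case using bridge.IH eq[of "length wd"] by (metis length_Cons)
qed simp

lemma sweep_positive_distinguished:
  assumes "sweep k n u wd es bs id F"
  shows "positive_distinguished n wd es u"
proof -
  have "\<forall>i\<in>set wd. Suc i < n" "length es = length wd" using sweep_lengths[OF assms] by auto
  then show ?thesis using sweep_partial_prod[OF assms] by (simp add: positive_distinguished_iff)
qed

text \<open>A word with a subexpression determines its sweep. The ascent condition yields the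
  comparisons of \<open>v\<close>; the last hypothesis, through \<open>sweep_token\<close>, yields
  those of \<open>F\<close>.\<close>

lemma sweep_exists:
  "length es = length wd \<Longrightarrow> \<forall>i\<in>set wd. Suc i < n \<Longrightarrow> v \<circ> partial_prod wd es (length wd) = u \<Longrightarrow>
    \<forall>j<length wd. (v \<circ> partial_prod wd es j) (wd ! j) < (v \<circ> partial_prod wd es j) (Suc (wd ! j)) \<Longrightarrow>
    \<forall>j<length wd. token k n u (pinv (word_perm (drop (Suc j) wd)) (Suc (wd ! j))) <
      token k n u (pinv (word_perm (drop (Suc j) wd)) (wd ! j)) \<Longrightarrow>
    \<exists>bs F. sweep k n u wd es bs v F"
proof (induction wd arbitrary: es v)
  case Nil
  then have "es = []" "v = u" by (auto simp: fun_eq_iff)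
  then show ?case using sweep.start by blast
next
  case (Cons i wd)
  obtain e es' where es: "es = e # es'" using Cons.prems(1) by (cases es) auto
  define v' where "v' = v \<circ> (if e then simple_refl i else id)"
  have eq: "v \<circ> partial_prod (i # wd) es (Suc j) = v' \<circ> partial_prod wd es' j" for j
    by (simp add: es partial_prod_Cons v'_def comp_assoc)
  have "\<exists>bs F. sweep k n u wd es' bs v' F"
  proof (rule Cons.IH)
    show "length es' = length wd" "\<forall>i\<in>set wd. Suc i < n" using Cons.prems(1,2) es by auto
    show "v' \<circ> partial_prod wd es' (length wd) = u"
      using Cons.prems(3) eq[of "length wd"] by (metis length_Cons)
    show "\<forall>j<length wd. (v' \<circ> partial_prod wd es' j) (wd ! j) <
        (v' \<circ> partial_prod wd es' j) (Suc (wd ! j))"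
    proof (intro allI impI)
      fix j assume "j < length wd"
      then show "(v' \<circ> partial_prod wd es' j) (wd ! j) < (v' \<circ> partial_prod wd es' j) (Suc (wd ! j))"
        using Cons.prems(4)[rule_format, of "Suc j"] unfolding eq by simp
    qed
    show "\<forall>j<length wd. token k n u (pinv (word_perm (drop (Suc j) wd)) (Suc (wd ! j))) <
      token k n u (pinv (word_perm (drop (Suc j) wd)) (wd ! j))"
    proof (intro allI impI)
      fix j assume "j < length wd"
      then show "token k n u (pinv (word_perm (drop (Suc j) wd)) (Suc (wd ! j))) <
        token k n u (pinv (word_perm (drop (Suc j) wd)) (wd ! j))"
        using Cons.prems(5)[rule_format, of "Suc j"] by simp
    qed
  qed
  then obtain bs F where sw: "sweep k n u wd es' bs v' F" by blast
  have i: "Suc i < n" using Cons.prems(2) by simp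
  have F: "F (Suc i) < F i"
    using Cons.prems(5)[rule_format, of 0] sweep_token[OF sw] by simp
  have asc: "v i < v (Suc i)" using Cons.prems(4)[rule_format, of 0] by simp
  show ?case
  proof (cases e)
    case True
    then have "v' = v \<circ> simple_refl i" by (simp add: v'_def)
    then have "v' (Suc i) < v' i" "v' \<circ> simple_refl i = v" using asc by (auto simp: comp_assoc)
    then show ?thesis using sweep.sort[OF sw i F] es True by auto
  next
    case False
    then have "v' = v" by (simp add: v'_def)
    then show ?thesis using sweep.bridge[OF sw i F] asc es False by auto
  qed
qed

end

lemma deodhar_to_bridge:
  assumes "k \<le> n" "0 < n" "kbruhat_le k n u w" "reduced_word n wd w" "positive_distinguished n wd es u"
  obtains bs where "bridge_graph k n (u ` {..<k}) bs (interval_affine_perm k n u w)"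
    "length bs = deodhar_dim es"
    "\<And>ts. length ts = length bs \<Longrightarrow> deodhar_param k n wd es ts = bridge_param k n (u ` {..<k}) bs ts"
proof -
  have u: "u permutes {..<n}" and w: "w permutes {..<n}" using kbruhat_le_permutes[OF assms(3)] .
  interpret sweep_start k n u by unfold_locales (use assms(1) u in auto)
  have wd: "\<forall>i\<in>set wd. Suc i < n" and wp: "w = word_perm wd"
    using assms(4) by (auto simp: reduced_word_def word_perm_def)
  have len: "length es = length wd" using assms(5) by (simp add: positive_distinguished_def)
  have pds: "partial_prod wd es (length wd) = u"
    "\<forall>j<length wd. partial_prod wd es j (wd ! j) < partial_prod wd es j (Suc (wd ! j))"
    using assms(5) positive_distinguished_iff[OF wd len] by auto
  have "token k n u (pinv (word_perm (drop (Suc j) wd)) (Suc (wd ! j))) <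
      token k n u (pinv (word_perm (drop (Suc j) wd)) (wd ! j))" if j: "j < length wd" for j
  proof -
    let ?p = "pinv (word_perm (drop (Suc j) wd)) (wd ! j)"
    let ?q = "pinv (word_perm (drop (Suc j) wd)) (Suc (wd ! j))"
    have "?p < ?q" "w ?q < w ?p" using reduced_word_suffix[OF assms(4) j] by auto
    \<comment> \<open>Strands that ascend under \<open>u\<close> but descend under \<open>w\<close>
      must lie on opposite sides of \<open>k\<close>, and then the shift by \<open>n\<close> makes
      the left token larger. Otherwise \<open>u\<close> already descends, and the left strand is
      shifted whenever the right one is.\<close>
    then have "?p < k \<and> k \<le> ?q \<or> \<not> u ?p < u ?q"
      using kbruhat_le_same_side[OF assms(3), of ?p ?q] by auto
    moreover have "u ?p \<noteq> u ?q" using injD[OF permutes_inj[OF u], of ?p ?q] \<open>?p < ?q\<close> by auto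
    moreover have "?q < n"
    proof -
      have "\<forall>i\<in>set (drop (Suc j) wd). Suc i < n" using wd by (meson in_set_dropD)
      from permutes_in_image[OF permutes_inv[OF permutes_word[OF this]], of "Suc (wd ! j)"]
      show ?thesis using wd j by simp
    qed
    then have "u ?q < n" using permutes_in_image[OF u] by simp
    ultimately show ?thesis using \<open>?p < ?q\<close> by (auto simp: token_def)
  qed
  then obtain bs F where sw: "sweep k n u wd es bs id F"
    using sweep_exists[of es wd id] len wd pds by auto
  show thesis
  proof
    have "F \<circ> pinv id = token k n u \<circ> pinv w" using sweep_token[OF sw] wp by (simp add: inv_id)
    then show "bridge_graph k n (u ` {..<k}) bs (interval_affine_perm k n u w)"
      using sweep_bridge_graph[OF assms(2) sw] interval_affine_perm_eq_periodic[OF assms(2) w] by simp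
    show "length bs = deodhar_dim es" using sweep_lengths[OF sw] by simp
    show "deodhar_param k n wd es ts = bridge_param k n (u ` {..<k}) bs ts" if "length ts = length bs" for ts
      using sweep_param[OF sw that] .
  qed
qed

section \<open>From bridge graphs to Deodhar parametrizations\<close>

text \<open>Sorting is done lazily: a lollipop in \<open>u ` {..<k}\<close> stays left, and any other lollipop stays right, of
  everything it starts out inverted with, until it gets its first bridge. The exceptions in \<open>A\<close> and
  \<open>B\<close> are the ends of the bridge that is being prepared.\<close>

definition spread_except :: "nat \<Rightarrow> nat set \<Rightarrow> nat set \<Rightarrow> (nat \<Rightarrow> nat) \<Rightarrow> (nat \<Rightarrow> int) \<Rightarrow> bool" where
  "spread_except n A B v F \<longleftrightarrow> (\<forall>p<n. \<forall>q<n. v q < v p \<longrightarrow>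
     (F p = int (v p) + int n \<and> v p \<notin> A \<longrightarrow> p < q) \<and> (F q = int (v q) \<and> v q \<notin> B \<longrightarrow> p < q))"

lemma spread_exceptD:
  assumes "spread_except n A B v F" "p < n" "q < n" "v q < v p"
  shows "F p = int (v p) + int n \<Longrightarrow> v p \<notin> A \<Longrightarrow> p < q"
    and "F q = int (v q) \<Longrightarrow> v q \<notin> B \<Longrightarrow> p < q"
  using assms unfolding spread_except_def by blast+

lemma permutes_ascending_id:
  assumes "v permutes {..<n}" "\<And>i. Suc i < n \<Longrightarrow> v i < v (Suc i)"
  shows "v = id"
proof -
  have "i < n \<Longrightarrow> i \<le> v i" for i
  proof (induction i)
    case (Suc i)
    then show ?case using assms(2)[of i] by simp
  qed simp
  then show ?thesis by (intro permutes_natset_ge[OF assms(1)]) auto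
qed

context sweep_start begin

text \<open>This makes the rule \<open>sort\<close> applicable at every descent of
  \<open>v\<close>.\<close>

lemma sweep_inversion_token:
  assumes "sweep k n u wd es bs v F" "p < q" "q < n" "v q < v p"
  shows "F q < F p"
  using sweep_inversion[OF assms] sweep_bounds[OF assms(1), of p] sweep_bounds[OF assms(1), of q]
    assms(2-4) by auto

text \<open>After the last bridge the remaining descents may be removed in any order, as sorting
  changes neither the bridges nor the bounded affine permutation.\<close>

lemma sweep_sort_id:
  "sweep k n u wd es bs v F \<Longrightarrow> \<exists>wd es. sweep k n u wd es bs id (F \<circ> pinv v)"
proof (induction "perm_length n v" arbitrary: wd es v F rule: less_induct)
  case less
  have v: "v permutes {..<n}" using sweep_permutes[OF less.prems] .
  show ?case
  proof (cases "v = id")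
    case True
    then have "F \<circ> pinv v = F" by (simp add: inv_id)
    then show ?thesis using less.prems True by auto
  next
    case False
    then obtain i where i: "Suc i < n" "\<not> v i < v (Suc i)" using permutes_ascending_id[OF v] by blast
    then have d: "v (Suc i) < v i"
      using injD[OF permutes_inj[OF v], of i "Suc i"] by linarith
    have sw: "sweep k n u (i # wd) (True # es) bs (v \<circ> simple_refl i) (F \<circ> simple_refl i)"
      using sweep.sort[OF less.prems i(1) _ d] sweep_inversion_token[OF less.prems _ i(1) d] by simp
    have "perm_length n (v \<circ> simple_refl i) < perm_length n v"
      using perm_length_descent[of i n v, OF i(1) d] by simp
    from less.hyps[OF this sw] show ?thesis unfolding comp_simple_refl_pinv(1)[OF v] .
  qed
qed

text \<open>While \<open>a\<close> and \<open>b\<close> are not adjacent, one descent between them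
  is sorted, which shortens \<open>v\<close>. The descent has to be chosen: exchanging a lollipop
  with a value it is meant to stay away from would break \<open>spread_except\<close>.\<close>

lemma sweep_gather:
  assumes ab: "a < b" "b < n" and lt: "\<phi> b < \<phi> a"
    and loll: "\<And>c. a < c \<Longrightarrow> c < b \<Longrightarrow> \<phi> c = int c \<or> \<phi> c = int c + int n"
  shows "sweep k n u wd es bs v F \<Longrightarrow> F \<circ> pinv v = \<phi> \<Longrightarrow> spread_except n {a} {b} v F \<Longrightarrow>
    \<exists>wd es v F i. sweep k n u wd es bs v F \<and> F \<circ> pinv v = \<phi> \<and> spread_except n {a} {b} v F \<and>
      Suc i < n \<and> v i = a \<and> v (Suc i) = b"
proof (induction "perm_length n v" arbitrary: wd es v F rule: less_induct)
  case less
  note sw = less.prems(1) and spread = less.prems(3)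
  have v: "v permutes {..<n}" using sweep_permutes[OF sw] .
  have phi: "\<phi> (v p) = F p" for p
    using less.prems(2) permutes_inverses(2)[OF v] by (metis comp_apply)
  define p where "p = pinv v a"
  define q where "q = pinv v b"
  have vp: "v p = a" and vq: "v q = b" by (auto simp: p_def q_def permutes_inverses[OF v])
  have pn: "p < n" and qn: "q < n"
    using permutes_in_image[OF permutes_inv[OF v]] ab by (auto simp: p_def q_def)
  have Fpq: "F q < F p" using lt phi[of p] phi[of q] vp vq by simp
  have pq: "p < q"
  proof (rule ccontr)
    assume "\<not> p < q"
    then have "q < p" using vp vq ab(1) by (metis linorder_neqE_nat less_irrefl)
    then show False using sweep_inversion_token[OF sw, of q p] pn vp vq ab(1) Fpq by simp
  qed
  show ?case
  proof (cases "q = Suc p")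
    case True
    then show ?thesis using less.prems vp vq qn by blast
  next
    case False
    \<comment> \<open>The position of \<open>a\<close> satisfies \<open>?H\<close> and that of
      \<open>b\<close> does not, so \<open>?H\<close> fails for the first time after some
      \<open>i\<close>. Values strictly between \<open>a\<close> and \<open>b\<close> are lollipops,
      which the spread condition keeps outside the segment, so this step is a descent unless it is
      the pair \<open>a\<close>, \<open>b\<close> itself.\<close>
    let ?H = "\<lambda>x. v x = a \<or> b < v x"
    have mid: "v x < a \<or> v x = b" if x: "p \<le> x" "x \<le> q" "\<not> ?H x" for x
    proof (rule ccontr)
      assume "\<not> (v x < a \<or> v x = b)"
      then have c: "a < v x" "v x < b" using x(3) by auto
      have xn: "x < n" using x(2) qn by simp
      have "F x = int (v x) \<or> F x = int (v x) + int n" using loll[OF c] phi[of x] by simp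
      then show False
      proof
        assume "F x = int (v x)"
        then have "q < x" using spread_exceptD(2)[OF spread qn xn] c vq by simp
        then show False using x(2) by simp
      next
        assume "F x = int (v x) + int n"
        then have "x < p" using spread_exceptD(1)[OF spread xn pn] c vp by simp
        then show False using x(1) by simp
      qed
    qed
    have "\<exists>i. p \<le> i \<and> i < q \<and> ?H i \<and> \<not> ?H (Suc i)"
    proof (rule ccontr)
      assume no: "\<nexists>i. p \<le> i \<and> i < q \<and> ?H i \<and> \<not> ?H (Suc i)"
      have "x \<le> q \<longrightarrow> ?H x" if "p \<le> x" for x
        using that
      proof (induction x rule: dec_induct)
        case base
        then show ?case using vp by simp
      next
        case (step x)
        show ?case
        proof
          assume "Suc x \<le> q"
          then have "x < q" "?H x" using step.IH by auto
          then show "?H (Suc x)" using no step.hyps(1) by blast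
        qed
      qed
      from this[of q] show False using pq vq ab(1) by simp
    qed
    then obtain i where i: "p \<le> i" "i < q" "?H i" "\<not> ?H (Suc i)" by blast
    have lo: "v (Suc i) < a \<or> v (Suc i) = b" using mid[of "Suc i"] i by simp
    have sin: "Suc i < n" using i(2) qn by simp
    have inj: "v x = v y \<longleftrightarrow> x = y" for x y using permutes_inj[OF v] by (simp add: inj_eq)
    have "\<not> (v i = a \<and> v (Suc i) = b)" using False vp vq inj by metis
    then have d: "v (Suc i) < v i" using i(3) lo ab(1) by auto
    have sw': "sweep k n u (i # wd) (True # es) bs (v \<circ> simple_refl i) (F \<circ> simple_refl i)"
      using sweep.sort[OF sw sin _ d] sweep_inversion_token[OF sw _ sin d] by simp
    have len: "perm_length n (v \<circ> simple_refl i) < perm_length n v"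
      using perm_length_descent[of i n v, OF sin d] by simp
    \<comment> \<open>A lollipop of the initial subset above \<open>b\<close> stands left of the
      smaller value \<open>a\<close>, hence outside the segment; \<open>low\<close> is the mirror
      image. The exchanged pair thus violates no condition except those waived for \<open>a\<close>
      and \<open>b\<close>.\<close>
    have hi: "F i \<noteq> int (v i) + int n \<or> v i = a"
    proof (rule ccontr)
      assume "\<not> ?thesis"
      then have "i < p" using spread_exceptD(1)[OF spread _ pn, of i] i(3) vp sin ab(1) by auto
      then show False using i(1) by simp
    qed
    have low: "F (Suc i) \<noteq> int (v (Suc i)) \<or> v (Suc i) = b"
    proof (rule ccontr)
      assume "\<not> ?thesis"
      then have "q < Suc i" using spread_exceptD(2)[OF spread qn sin] lo vq ab(1) by auto
      then show False using i(2) by simp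
    qed
    have "spread_except n {a} {b} (v \<circ> simple_refl i) (F \<circ> simple_refl i)"
      unfolding spread_except_def
    proof (intro allI impI)
      fix x y assume xy: "x < n" "y < n" "(v \<circ> simple_refl i) y < (v \<circ> simple_refl i) x"
      let ?x = "simple_refl i x" and ?y = "simple_refl i y"
      have n: "?x < n" "?y < n" using xy simple_refl_less[OF sin] by auto
      have unswap: "x < y" if le: "?x < ?y" and ne: "(?x, ?y) \<noteq> (i, Suc i)"
        using simple_refl_mono[OF le ne] by simp
      show "((F \<circ> simple_refl i) x = int ((v \<circ> simple_refl i) x) + int n \<and> (v \<circ> simple_refl i) x \<notin> {a} \<longrightarrow> x < y) \<and>
        ((F \<circ> simple_refl i) y = int ((v \<circ> simple_refl i) y) \<and> (v \<circ> simple_refl i) y \<notin> {b} \<longrightarrow> x < y)"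
      proof (cases "?x = i \<and> ?y = Suc i")
        case True
        then show ?thesis using hi low by auto
      next
        case False
        then show ?thesis using spread_exceptD[OF spread n] xy(3) unswap by auto
      qed
    qed
    moreover have "F \<circ> simple_refl i \<circ> pinv (v \<circ> simple_refl i) = \<phi>"
      unfolding comp_simple_refl_pinv(1)[OF v] by (rule less.prems(2))
    ultimately show ?thesis using less.hyps[OF len sw'] by blast
  qed
qed

text \<open>In both cases of \<open>spread_except\<close> the token of \<open>p\<close> exceeds that
  of \<open>q\<close>, and descending tokens translate this into \<open>p < q\<close>.\<close>

lemma token_spread:
  assumes desc: "\<And>p q. p < q \<Longrightarrow> q < n \<Longrightarrow> token k n u q < token k n u p"
  shows "spread_except n {} {} u (token k n u)"
  unfolding spread_except_def
proof (intro allI impI)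
  fix p q assume pq: "p < n" "q < n" "u q < u p"
  have "q \<noteq> p" using pq(3) by auto
  then have "p < q" if "token k n u q \<le> token k n u p" using desc[of q p] that pq(1) by linarith
  then show "(token k n u p = int (u p) + int n \<and> u p \<notin> {} \<longrightarrow> p < q) \<and>
      (token k n u q = int (u q) \<and> u q \<notin> {} \<longrightarrow> p < q)"
    using pq(3) by (auto simp: token_def split: if_splits)
qed

text \<open>With tokens descending in the positions of \<open>u\<close>, a larger token belongs to a
  smaller starting position. Each letter therefore crosses two strands that are still in their
  original order, and the length grows by one.\<close>

lemma sweep_reduced:
  assumes "\<And>p q. p < q \<Longrightarrow> q < n \<Longrightarrow> token k n u q < token k n u p"
  shows "sweep k n u wd es bs v F \<Longrightarrow> perm_length n (word_perm wd) = length wd"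
proof -
  have step: "perm_length n (word_perm (i # wd)) = length (i # wd)"
    if sw: "sweep k n u wd es bs v F" and i: "Suc i < n" "F (Suc i) < F i"
      and IH: "perm_length n (word_perm wd) = length wd" for wd es bs v F i
  proof -
    let ?y = "word_perm wd"
    have y: "?y permutes {..<n}" using sweep_lengths[OF sw] by (intro permutes_word) simp
    have "pinv ?y i < n" using permutes_in_image[OF permutes_inv[OF y]] i(1) by simp
    moreover have "pinv ?y i \<noteq> pinv ?y (Suc i)"
      using injD[OF permutes_inj[OF permutes_inv[OF y]], of i "Suc i"] by auto
    moreover have "token k n u (pinv ?y (Suc i)) < token k n u (pinv ?y i)"
      using i(2) sweep_token[OF sw] by simp
    ultimately have "pinv ?y i < pinv ?y (Suc i)"
      using assms[of "pinv ?y (Suc i)" "pinv ?y i"] by linarith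
    then show ?thesis using perm_length_left_ascent[OF y i(1)] IH by simp
  qed
  show "sweep k n u wd es bs v F \<Longrightarrow> perm_length n (word_perm wd) = length wd"
  proof (induction rule: sweep.induct)
    case start
    show ?case by (metis perm_length_id list.size(3) word_perm_simps(1))
  next
    case (sort wd es bs v F i)
    then show ?case using step by blast
  next
    case (bridge wd es bs v F i)
    then show ?case using step by blast
  qed
qed

lemma bridge_graph_sweep:
  assumes "0 < n" and desc: "\<And>p q. p < q \<Longrightarrow> q < n \<Longrightarrow> token k n u q < token k n u p"
  shows "bridge_graph k n (u ` {..<k}) bs f \<Longrightarrow>
    \<exists>wd es v F. sweep k n u wd es bs v F \<and> f = periodic n (F \<circ> pinv v) \<and> spread_except n {} {} v F"
proof (induction rule: bridge_graph.induct)
  case lollipops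
  show ?case
    using sweep.start translation_eq_token[OF assms(1)] token_spread[OF desc] by blast
next
  case (add_bridge bs f a b)
  then obtain wd es v F where sw: "sweep k n u wd es bs v F" and f: "f = periodic n (F \<circ> pinv v)"
    and spread: "spread_except n {} {} v F" by blast
  have v: "v permutes {..<n}" using sweep_permutes[OF sw] .
  let ?\<phi> = "F \<circ> pinv v"
  have lt: "?\<phi> b < ?\<phi> a" using add_bridge(2-4) f by (simp add: periodic_of_nat)
  have loll: "?\<phi> c = int c \<or> ?\<phi> c = int c + int n" if c: "a < c" "c < b" for c
  proof -
    have "pinv v c < n" using permutes_in_image[OF permutes_inv[OF v]] c add_bridge(3) by simp
    moreover have "lollipop bs c" using add_bridge(5) c by auto
    ultimately show ?thesis
      using sweep_lollipop[OF sw, of "pinv v c"] by (simp add: permutes_inverses[OF v] split: if_splits)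
  qed
  have "spread_except n {a} {b} v F" using spread unfolding spread_except_def by blast
  from sweep_gather[of a b ?\<phi>, OF add_bridge(2,3) lt loll sw refl this] obtain wd' es' v' F' i where sw': "sweep k n u wd' es' bs v' F'"
    and phi: "F' \<circ> pinv v' = ?\<phi>" and spread': "spread_except n {a} {b} v' F'"
    and i: "Suc i < n" "v' i = a" "v' (Suc i) = b"
    by blast
  have v': "v' permutes {..<n}" using sweep_permutes[OF sw'] .
  have F': "F' (pinv v' x) = ?\<phi> x" for x using phi by (simp add: fun_eq_iff)
  have Fab: "F' i = ?\<phi> a" "F' (Suc i) = ?\<phi> b"
    using F'[of a] F'[of b] i(2,3) permutes_inverses(2)[OF v'] by metis+
  have "sweep k n u (i # wd') (False # es') (bs @ [(a, b)]) v' (F' \<circ> simple_refl i)"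
    using sweep.bridge[OF sw' i(1)] lt Fab i(2,3) add_bridge(2) by auto
  moreover have "f \<circ> affine_ext n (transpose a b) = periodic n (F' \<circ> simple_refl i \<circ> pinv v')"
  proof -
    have "transpose a b permutes {..<n}" using add_bridge(2,3) by (intro permutes_swap_id) auto
    then show ?thesis
      unfolding f comp_simple_refl_pinv(2)[OF v'] phi i(2,3)
      by (rule periodic_comp_affine_ext[OF assms(1)])
  qed
  moreover have "spread_except n {} {} v' (F' \<circ> simple_refl i)"
    unfolding spread_except_def
  proof (intro allI impI)
    fix p q assume pq: "p < n" "q < n" "v' q < v' p"
    have bd: "F' i \<le> int a + int n" "int b \<le> F' (Suc i)"
      using sweep_bounds[OF sw', of i] sweep_bounds[OF sw', of "Suc i"] i by auto
    have lt': "F' (Suc i) < F' i" using lt Fab by simp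
    have eq: "x \<in> {i, Suc i} \<or> (F' \<circ> simple_refl i) x = F' x \<and> v' x \<noteq> a \<and> v' x \<noteq> b" for x
      using inj_eq[OF permutes_inj[OF v']] i by (auto simp: simple_refl_other)
    have ends: "(F' \<circ> simple_refl i) x \<noteq> int (v' x) + int n" "(F' \<circ> simple_refl i) x \<noteq> int (v' x)"
      if "x \<in> {i, Suc i}" for x
      using that bd lt' i add_bridge(2) by auto
    show "((F' \<circ> simple_refl i) p = int (v' p) + int n \<and> v' p \<notin> {} \<longrightarrow> p < q) \<and>
        ((F' \<circ> simple_refl i) q = int (v' q) \<and> v' q \<notin> {} \<longrightarrow> p < q)"
      using spread_exceptD(1)[OF spread' pq] spread_exceptD(2)[OF spread' pq]
        eq[of p] eq[of q] ends(1)[of p] ends(2)[of q] by (metis empty_iff singletonD)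
  qed
  ultimately show ?case by blast
qed

end

section \<open>Choice of the representative and recovery of the initial subset\<close>

lemma perm_length_le: "perm_length n v \<le> n * n"
proof -
  have "perm_length n v \<le> card ({..<n} \<times> {..<n})"
    unfolding perm_length_def by (intro card_mono) auto
  then show ?thesis by simp
qed

lemma token_simple_refl:
  assumes "Suc i \<noteq> k"
  shows "token k n (u \<circ> simple_refl i) = token k n u \<circ> simple_refl i"
proof
  fix p
  have "simple_refl i p < k \<longleftrightarrow> p < k" using assms by (auto simp: simple_refl_def transpose_def)
  then show "token k n (u \<circ> simple_refl i) p = (token k n u \<circ> simple_refl i) p"
    by (simp add: token_def)
qed

text \<open>A given pair \<open>(u, w)\<close> need not realize every bridge graph of its positroid variety: for
  \<open>k = 1\<close>, \<open>n = 3\<close> and \<open>u = id\<close> the bridges \<open>(0, 2), (0, 1)\<close> do not occur. The longest \<open>u\<close> does.\<close>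

lemma kbruhat_representative:
  assumes "0 < n"
  shows "kbruhat_le k n u w \<Longrightarrow> \<exists>u' w'. kbruhat_le k n u' w' \<and>
    projected_richardson k n u' w' = projected_richardson k n u w \<and>
    interval_affine_perm k n u' w' = interval_affine_perm k n u w \<and>
    (\<forall>i. Suc i < n \<longrightarrow> Suc i \<noteq> k \<longrightarrow> u' (Suc i) < u' i)"
proof (induction "n * n - perm_length n u" arbitrary: u w rule: less_induct)
  case less
  have u: "u permutes {..<n}" and w: "w permutes {..<n}" using kbruhat_le_permutes[OF less.prems] .
  show ?case
  proof (cases "\<forall>i. Suc i < n \<longrightarrow> Suc i \<noteq> k \<longrightarrow> u (Suc i) < u i")
    case True
    then show ?thesis using less.prems by blast
  next
    case False
    then obtain i where i: "Suc i < n" "Suc i \<noteq> k" "\<not> u (Suc i) < u i" by blast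
    have asc: "u i < u (Suc i)" using i(3) injD[OF permutes_inj[OF u], of i "Suc i"] by linarith
    have wasc: "w i < w (Suc i)"
      using kbruhat_le_same_side[OF less.prems lessI _ asc] i(2) by simp
    let ?u = "u \<circ> simple_refl i" and ?w = "w \<circ> simple_refl i"
    have "perm_length n ?u = Suc (perm_length n u)" using perm_length_ascent[of i n u, OF i(1) asc] .
    then have "n * n - perm_length n ?u < n * n - perm_length n u"
      using perm_length_le[of n ?u] by simp
    from less.hyps[OF this kbruhat_le_simple_refl[OF less.prems i(1,2) asc]]
    obtain u' w' where uw': "kbruhat_le k n u' w'"
      "projected_richardson k n u' w' = projected_richardson k n ?u ?w"
      "interval_affine_perm k n u' w' = interval_affine_perm k n ?u ?w"
      "\<forall>i. Suc i < n \<longrightarrow> Suc i \<noteq> k \<longrightarrow> u' (Suc i) < u' i" by blast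
    have ws: "?w permutes {..<n}" by (rule permutes_compose[OF permutes_simple_refl[OF i(1)] w])
    have "interval_affine_perm k n ?u ?w = interval_affine_perm k n u w"
      unfolding interval_affine_perm_eq_periodic[OF assms ws] interval_affine_perm_eq_periodic[OF assms w]
        token_simple_refl[OF i(2)] comp_simple_refl_pinv(1)[OF w] ..
    moreover note projected_richardson_simple_refl[OF u w i(1,2) asc wasc]
    ultimately show ?thesis using uw' by metis
  qed
qed

lemma token_descending:
  assumes "u permutes {..<n}" "\<And>i. Suc i < n \<Longrightarrow> Suc i \<noteq> k \<Longrightarrow> u (Suc i) < u i"
  shows "p < q \<Longrightarrow> q < n \<Longrightarrow> token k n u q < token k n u p"
proof (induction q rule: less_Suc_induct[of p, consumes 1])
  case (1 i)
  then show ?case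
    using assms(2)[of i] permutes_in_image[OF assms(1), of "Suc i"] by (auto simp: token_def)
next
  case (2 i j l)
  then show ?case by simp
qed

lemma token_inj:
  assumes "\<And>p q. p < q \<Longrightarrow> q < n \<Longrightarrow> token k n u q < token k n u p"
  shows "inj_on (token k n u) {..<n}"
proof (rule inj_onI)
  fix p q assume pq: "p \<in> {..<n}" "q \<in> {..<n}" "token k n u p = token k n u q"
  then have "\<not> p < q" "\<not> q < p" using assms[of p q] assms[of q p] by auto
  then show "p = q" by simp
qed

lemma periodic_inject:
  assumes "periodic n \<phi> = periodic n \<psi>" "x < n"
  shows "\<phi> x = \<psi> x"
  using assms periodic_of_nat[of x n] by metis

lemma bridge_graph_image:
  assumes "0 < n"
  shows "bridge_graph k n S bs f \<Longrightarrow> S \<subseteq> {..<n} \<and>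
    (\<exists>\<phi>. f = periodic n \<phi> \<and> \<phi> ` {..<n} = (\<lambda>x. int x + (if x \<in> S then int n else 0)) ` {..<n})"
proof (induction rule: bridge_graph.induct)
  case lollipops
  then show ?case using translation_eq_periodic[OF assms] by blast
next
  case (add_bridge bs f a b)
  then obtain \<phi> where \<phi>: "f = periodic n \<phi>"
    "\<phi> ` {..<n} = (\<lambda>x. int x + (if x \<in> S then int n else 0)) ` {..<n}" by blast
  have p: "transpose a b permutes {..<n}" using add_bridge(2,3) by (intro permutes_swap_id) auto
  have "(\<phi> \<circ> transpose a b) ` {..<n} = \<phi> ` {..<n}"
    using permutes_image[OF p] by (metis image_comp)
  then show ?case using \<phi> periodic_comp_affine_ext[OF assms p] add_bridge.IH by metis
qed

text \<open>Bridges only permute the values on \<open>[n]\<close>, and among these the ones that are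
  at least \<open>n\<close> are \<open>x + n\<close> for \<open>x \<in> S\<close>. The tokens of
  \<open>u\<close> show the same values as \<open>u p + n\<close> for \<open>p < k\<close>.\<close>

lemma bridge_graph_subset_eq:
  assumes "0 < n" "k \<le> n" "u permutes {..<n}" "w permutes {..<n}"
    "bridge_graph k n S bs (interval_affine_perm k n u w)"
  shows "S = u ` {..<k}"
proof -
  let ?\<sigma> = "\<lambda>x. int x + (if x \<in> S then int n else 0)"
  obtain \<phi> where S: "S \<subseteq> {..<n}" and \<phi>: "interval_affine_perm k n u w = periodic n \<phi>"
    "\<phi> ` {..<n} = ?\<sigma> ` {..<n}"
    using bridge_graph_image[OF assms(1,5)] by blast
  have "\<phi> x = token k n u (pinv w x)" if "x < n" for x
    using \<phi>(1) interval_affine_perm_eq_periodic[OF assms(1,4)] periodic_inject[of n \<phi> _ x] that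
    by (metis comp_apply)
  then have "\<phi> ` {..<n} = token k n u ` pinv w ` {..<n}" by (auto simp: image_iff)
  then have im: "?\<sigma> ` {..<n} = token k n u ` {..<n}"
    using \<phi>(2) permutes_image[OF permutes_inv[OF assms(4)]] by simp
  have un: "u p < n" if "p < n" for p using permutes_in_image[OF assms(3)] that by simp
  show ?thesis
  proof (intro equalityI subsetI)
    fix x assume x: "x \<in> S"
    then have "int x + int n \<in> token k n u ` {..<n}" using S im by (force simp flip: im)
    then obtain p where p: "p < n" "token k n u p = int x + int n" by auto
    then have "p < k" "u p = x" using un[OF p(1)] by (auto simp: token_def split: if_splits)
    then show "x \<in> u ` {..<k}" by auto
  next
    fix x assume "x \<in> u ` {..<k}"
    then obtain p where p: "p < k" "x = u p" by auto
    then have "int x + int n \<in> token k n u ` {..<n}"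
      using assms(2) by (intro image_eqI[of _ _ p]) (auto simp: token_def)
    then obtain y where "y < n" "?\<sigma> y = int x + int n" unfolding im[symmetric] by auto
    then show "x \<in> S" by (auto split: if_splits)
  qed
qed

lemma bridge_to_deodhar:
  assumes "k \<le> n" "0 < n" "kbruhat_le k n u w" "bridge_graph k n S bs (interval_affine_perm k n u w)"
  obtains u' w' wd es where "kbruhat_le k n u' w'"
    "projected_richardson k n u' w' = projected_richardson k n u w"
    "reduced_word n wd w'" "positive_distinguished n wd es u'" "deodhar_dim es = length bs"
    "\<And>ts. length ts = length bs \<Longrightarrow> deodhar_param k n wd es ts = bridge_param k n S bs ts"
proof -
  obtain u' w' where le: "kbruhat_le k n u' w'"
    and X: "projected_richardson k n u' w' = projected_richardson k n u w"
    and f: "interval_affine_perm k n u' w' = interval_affine_perm k n u w"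
    and desc: "\<forall>i. Suc i < n \<longrightarrow> Suc i \<noteq> k \<longrightarrow> u' (Suc i) < u' i"
    using kbruhat_representative[OF assms(2,3)] by blast
  have u': "u' permutes {..<n}" and w': "w' permutes {..<n}" using kbruhat_le_permutes[OF le] .
  have bg: "bridge_graph k n S bs (interval_affine_perm k n u' w')" using assms(4) f by simp
  have S: "S = u' ` {..<k}" by (rule bridge_graph_subset_eq[OF assms(2,1) u' w' bg])
  interpret sweep_start k n u' by unfold_locales (use assms(1) u' in auto)
  have td: "token k n u' q < token k n u' p" if "p < q" "q < n" for p q
    using token_descending[OF u' _ that] desc by blast
  obtain wd0 es0 v F where sw0: "sweep k n u' wd0 es0 bs v F"
    and per: "interval_affine_perm k n u' w' = periodic n (F \<circ> pinv v)"
    using bridge_graph_sweep[OF assms(2) td] bg S by blast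
  obtain wd es where sw: "sweep k n u' wd es bs id (F \<circ> pinv v)"
    using sweep_sort_id[OF sw0] by blast
  have wd: "\<forall>i\<in>set wd. Suc i < n" using sweep_lengths[OF sw] by simp
  have wp: "word_perm wd permutes {..<n}" by (rule permutes_word[OF wd])
  \<comment> \<open>Descending tokens are pairwise distinct, so the bounded affine permutation
    determines the permutation of the word, which must be \<open>w'\<close>.\<close>
  have "pinv (word_perm wd) x = pinv w' x" for x
  proof (cases "x < n")
    case True
    have "token k n u' (pinv (word_perm wd) x) = token k n u' (pinv w' x)"
      using per interval_affine_perm_eq_periodic[OF assms(2) w'] sweep_token[OF sw]
        periodic_inject[OF _ True] by (metis comp_apply)
    moreover have "pinv (word_perm wd) x \<in> {..<n}" "pinv w' x \<in> {..<n}"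
      using permutes_in_image[OF permutes_inv[OF wp]] permutes_in_image[OF permutes_inv[OF w']] True
      by auto
    ultimately show ?thesis using inj_onD[OF token_inj[OF td]] by blast
  next
    case False
    then show ?thesis
      using permutes_not_in[OF permutes_inv[OF wp]] permutes_not_in[OF permutes_inv[OF w']] by simp
  qed
  then have "pinv (word_perm wd) = pinv w'" by blast
  then have "word_perm wd = w'" using permutes_inv_inv[OF wp] permutes_inv_inv[OF w'] by metis
  then have red: "reduced_word n wd w'"
    using wd sweep_reduced[OF td sw] unfolding reduced_word_def word_perm_def by simp
  show thesis
  proof (rule that[OF le X red])
    show "positive_distinguished n wd es u'" by (rule sweep_positive_distinguished[OF sw])
    show "deodhar_dim es = length bs" using sweep_lengths[OF sw] by simp
    show "deodhar_param k n wd es ts = bridge_param k n S bs ts" if "length ts = length bs" for ts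
      using sweep_param[OF sw that] S by simp
  qed
qed

theorem theorem1p1:
  fixes k n :: nat and X :: "complex vec set set"
  assumes "k \<le> n" and "0 < n" and "positroid_variety k n X"
  shows "(\<forall>wd es. projected_deodhar_for k n X wd es \<longrightarrow>
            (\<exists>S bs. bridge_graph_for k n X S bs \<and> length bs = deodhar_dim es \<and>
               (\<forall>ts\<in>torus (deodhar_dim es). bridge_param k n S bs ts = deodhar_param k n wd es ts))) \<and>
         (\<forall>S bs. bridge_graph_for k n X S bs \<longrightarrow>
            (\<exists>wd es. projected_deodhar_for k n X wd es \<and> deodhar_dim es = length bs \<and>
               (\<forall>ts\<in>torus (length bs). deodhar_param k n wd es ts = bridge_param k n S bs ts)))"
proof (intro conjI allI impI)
  fix wd es assume "projected_deodhar_for k n X wd es"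
  then obtain u w where uw: "kbruhat_le k n u w" "X = projected_richardson k n u w"
    "reduced_word n wd w" "positive_distinguished n wd es u"
    by (auto simp: projected_deodhar_for_def)
  obtain bs where "bridge_graph k n (u ` {..<k}) bs (interval_affine_perm k n u w)"
    "length bs = deodhar_dim es"
    "\<And>ts. length ts = length bs \<Longrightarrow> deodhar_param k n wd es ts = bridge_param k n (u ` {..<k}) bs ts"
    using deodhar_to_bridge[OF assms(1,2) uw(1,3,4)] by blast
  then show "\<exists>S bs. bridge_graph_for k n X S bs \<and> length bs = deodhar_dim es \<and>
      (\<forall>ts\<in>torus (deodhar_dim es). bridge_param k n S bs ts = deodhar_param k n wd es ts)"
    using uw(1,2) unfolding bridge_graph_for_def torus_def
    by (intro exI[of _ "u ` {..<k}"] exI[of _ bs]) auto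
next
  fix S bs assume "bridge_graph_for k n X S bs"
  then obtain u w where uw: "kbruhat_le k n u w" "X = projected_richardson k n u w"
    "bridge_graph k n S bs (interval_affine_perm k n u w)"
    by (auto simp: bridge_graph_for_def)
  obtain u' w' wd es where res: "kbruhat_le k n u' w'"
    "projected_richardson k n u' w' = projected_richardson k n u w"
    "reduced_word n wd w'" "positive_distinguished n wd es u'" "deodhar_dim es = length bs"
    "\<And>ts. length ts = length bs \<Longrightarrow> deodhar_param k n wd es ts = bridge_param k n S bs ts"
    using bridge_to_deodhar[OF assms(1,2) uw(1,3)] by blast
  have "projected_deodhar_for k n X wd es"
    unfolding projected_deodhar_for_def using res(1-4) uw(2) by metis
  then show "\<exists>wd es. projected_deodhar_for k n X wd es \<and> deodhar_dim es = length bs \<and>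
      (\<forall>ts\<in>torus (length bs). deodhar_param k n wd es ts = bridge_param k n S bs ts)"
    using res(5,6) by (intro exI[of _ wd] exI[of _ es]) (auto simp: torus_def)
qed

end
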